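(* Let $\mathbb{K}$ be a field of characteristic $0$, $R=\mathbb{K}[x_1,\dots,x_n]$, $\mathcal{S}=\mathbb{K}[x_0,\dots,x_n]$, and let $f\in\mathcal{S}_d$ have a Generalized Additive Decomposition $f=\sum_{i=1}^s\omega_i\ell_i^{d-k_i}$ with $\ell_i=x_0+\xi_{i,1}x_1+\dots+\xi_{i,n}x_n$, $\xi_i\in\mathbb{K}^n$. Let $\varphi:=\sum_{i=1}^s\omega_i^{d,\ell_i,\mathbf x}(\mathbf z)\,e_{\xi_i}(\mathbf z)\in\mathbb{K}[[z_1,\dots,z_n]]\cong R^*$, $I_\varphi:=\{p\in R: p\star\varphi=0\}$ and $\mathcal{A}_\varphi:=R/I_\varphi$. Let $B,B'\subseteq R$ be sets whose classes form bases of $\mathcal{A}_\varphi$, with $1\in B$. Let $c\le d$ and let $A\subseteq R_{\le c}$, $A'\subseteq R_{\le d-c}$ be linearly independent sets with $B^+\subseteq\langle A\rangle$ and $B'\subseteq\langle A'\rangle$, where $B^+:=B\cup x_1B\cup\dots\cup x_nB$. Let $H:=H^{A',A}_{\check f}$ be the matrix of the operator $\mathbf H:=\mathbf H^{A',A}_{\check f}$. Then: (1) $H_0:=H^{B',B}_{\check f}$ is invertible; (2) $\operatorname{rank}H=\dim\mathcal{A}_\varphi=\sum_{i=1}^s\dim\langle\omega_i\rangle^{d,\ell_i,\mathbf x}$; (3) for $1\le i\le n$, with $H_i:=H^{B',x_iB}_{\check f}$, the matrix $H_0^{-1}H_i$ is the matrix of multiplication by $x_i$ on $\mathcal{A}_\varphi$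 in the basis $B$; (4) $\ker\mathbf H=I_\varphi\cap\langle A\rangle$, the ideal generated by $\ker\mathbf H$ equals $I_\varphi$, and $\operatorname{im}\mathbf H=\{\psi|_{\langle A'\rangle}:\psi\in R^*,\ \psi(I_\varphi)=0\}$.
   Context: $R^*$ is identified with $\mathbb{K}[[\mathbf z]]=\mathbb{K}[[z_1,\dots,z_n]]$ via $\sum_\alpha\varphi_\alpha\mathbf z^\alpha/\alpha!\leftrightarrow(\mathbf x^\alpha\mapsto\varphi_\alpha)$; for $p\in R$, $p\star\varphi$ is $q\mapsto\varphi(pq)$; $e_\xi(\mathbf z)=\exp(\sum\xi_iz_i)$ (the evaluation at $\xi$). A GAD of $f\in\mathcal{S}_d$ is $f=\sum_i\omega_i\ell_i^{d-k_i}$ with $0\le k_i\le d$, $\omega_i\in\mathcal{S}_{k_i}$, $\ell_i\in\mathcal{S}_1$ pairwise non-proportional, $\ell_i\nmid\omega_i$. For $\omega\in\mathcal{S}_k$, $\ell=x_0+\sum\xi_jx_j$ and $d\ge k$: write $\omega=\sum_{j=0}^k\omega_j\ell^{k-j}$ with $\omega_j\in\mathbb{K}[x_1,\dots,x_n]_j$, set $\omega^{d,\ell,\mathbf x}:=\frac1{d!}\sum_j(d-j)!\,\omega_j\in R$ (read in the variables $\mathbf z$ when used as a series), and $\langle\omega\rangle^{d,\ell,\mathbf x}:=\operatorname{span}\{g(\partial_{x_1},\dots,\partial_{x_n})(\omega^{d,\ell,\mathbf x}):g\in R\}$. $f^*\in\mathcal{S}_d^*$ is $\frac1{d!}f(z_0,\dots,z_n)$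 (functional $\underline{\mathbf x}^\alpha\mapsto$ coefficient read via $\underline{\mathbf z}^\alpha/\alpha!$ duality), and $\check f\in R_{\le d}^*$ is $\check f(p):=f^*(x_0^dp(x_1/x_0,\dots,x_n/x_0))$. For finite sets $P,Q\subseteq R$ with $\deg(pq)\le d$ for $p\in P,q\in Q$, $H^{Q,P}_{\check f}:=(\check f(qp))_{q\in Q,p\in P}$ (rows indexed by $Q$), and $\mathbf H^{Q,P}_{\check f}:\langle P\rangle\to\langle Q\rangle^*$, $p\mapsto(q\mapsto\check f(pq))$. The matrix of multiplication by $x_i$ in basis $B=(b_j)$ has $j$-th column the coordinates of $x_ib_j$ in $\mathcal{A}_\varphi$. *)

theory Defs
  imports "HOL-Library.Poly_Mapping" "HOL-Library.FuncSet"
    "Jordan_Normal_Form.DL_Rank" "Jordan_Normal_Form.Gauss_Jordan_Elimination"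
begin

text \<open>Monomials x^alpha are finitely supported exponent vectors (variable index to exponent);
  polynomials are finitely supported maps from monomials to coefficients.
  Variable x_0 has index 0, variables x_1..x_n have indices 1..n.
  R = K[x_1..x_n] is the set of polynomials only involving indices 1..n,
  S = K[x_0..x_n] those only involving indices 0..n.\<close>

type_synonym mon = "nat \<Rightarrow>\<^sub>0 nat"
type_synonym 'a mpoly = "mon \<Rightarrow>\<^sub>0 'a"

definition smult_mp :: "'a::field \<Rightarrow> 'a mpoly \<Rightarrow> 'a mpoly" where
  "smult_mp c p = Poly_Mapping.map (\<lambda>a. c * a) p"

abbreviation mspan :: "'a::field mpoly set \<Rightarrow> 'a mpoly set" where
  "mspan \<equiv> Modules.module.span smult_mp"

abbreviation mindep :: "'a::field mpoly set \<Rightarrow> bool" where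
  "mindep X \<equiv> \<not> Modules.module.dependent smult_mp X"

abbreviation mdim :: "'a::field mpoly set \<Rightarrow> nat" where
  "mdim \<equiv> Vector_Spaces.vector_space.dim smult_mp"

definition Var :: "nat \<Rightarrow> 'a::field mpoly" where
  "Var i = Poly_Mapping.single (Poly_Mapping.single i 1) 1"

definition mon_deg :: "mon \<Rightarrow> nat" where
  "mon_deg \<alpha> = (\<Sum>i\<in>Poly_Mapping.keys \<alpha>. Poly_Mapping.lookup \<alpha> i)"

definition mon_fact :: "mon \<Rightarrow> nat" where
  "mon_fact \<alpha> = (\<Prod>i\<in>Poly_Mapping.keys \<alpha>. fact (Poly_Mapping.lookup \<alpha> i))"

definition Rpolys :: "nat \<Rightarrow> 'a::field mpoly set" where
  "Rpolys n = {p. \<forall>\<alpha>\<in>Poly_Mapping.keys p. Poly_Mapping.keys \<alpha> \<subseteq> {1..n}}"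

definition Rle :: "nat \<Rightarrow> nat \<Rightarrow> 'a::field mpoly set" where
  "Rle n c = {p \<in> Rpolys n. \<forall>\<alpha>\<in>Poly_Mapping.keys p. mon_deg \<alpha> \<le> c}"

definition Rhom :: "nat \<Rightarrow> nat \<Rightarrow> 'a::field mpoly set" where
  "Rhom n j = {p \<in> Rpolys n. \<forall>\<alpha>\<in>Poly_Mapping.keys p. mon_deg \<alpha> = j}"

definition Shom :: "nat \<Rightarrow> nat \<Rightarrow> 'a::field mpoly set" where
  "Shom n d = {p. \<forall>\<alpha>\<in>Poly_Mapping.keys p. Poly_Mapping.keys \<alpha> \<subseteq> {0..n} \<and> mon_deg \<alpha> = d}"

definition lin_form :: "nat \<Rightarrow> (nat \<Rightarrow> 'a::field) \<Rightarrow> 'a mpoly" where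
  "lin_form n \<xi> = Var 0 + (\<Sum>j=1..n. smult_mp (\<xi> j) (Var j))"

definition is_GAD :: "nat \<Rightarrow> nat \<Rightarrow> 'a::field mpoly \<Rightarrow> nat \<Rightarrow> (nat \<Rightarrow> 'a mpoly)
    \<Rightarrow> (nat \<Rightarrow> nat) \<Rightarrow> (nat \<Rightarrow> nat \<Rightarrow> 'a) \<Rightarrow> bool" where
  "is_GAD n d f s \<omega> k \<xi> \<longleftrightarrow>
     (\<forall>i<s. k i \<le> d \<and> \<omega> i \<in> Shom n (k i) \<and> \<not> (lin_form n (\<xi> i) dvd \<omega> i)) \<and>
     (\<forall>i<s. \<forall>j<s. i \<noteq> j \<longrightarrow> \<not> (\<exists>a. lin_form n (\<xi> i) = smult_mp a (lin_form n (\<xi> j)))) \<and>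
     f = (\<Sum>i<s. \<omega> i * lin_form n (\<xi> i) ^ (d - k i))"

definition omega_comps :: "nat \<Rightarrow> 'a::field mpoly \<Rightarrow> nat \<Rightarrow> 'a mpoly \<Rightarrow> nat \<Rightarrow> 'a mpoly" where
  "omega_comps n l k \<omega> = (THE w. (\<forall>j. w j \<in> Rhom n j) \<and> (\<forall>j>k. w j = 0) \<and>
      \<omega> = (\<Sum>j\<le>k. w j * l ^ (k - j)))"

definition omega_dl :: "nat \<Rightarrow> nat \<Rightarrow> 'a::field mpoly \<Rightarrow> nat \<Rightarrow> 'a mpoly \<Rightarrow> 'a mpoly" where
  "omega_dl n d l k \<omega> =
     smult_mp (1 / of_nat (fact d :: nat)) (\<Sum>j\<le>k. smult_mp (of_nat (fact (d - j) :: nat)) (omega_comps n l k \<omega> j))"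

definition pdiff_mon :: "mon \<Rightarrow> 'a::field_char_0 mpoly \<Rightarrow> 'a mpoly" where
  "pdiff_mon \<beta> p = Abs_poly_mapping (\<lambda>\<gamma>.
      Poly_Mapping.lookup p (\<gamma> + \<beta>) * of_nat (mon_fact (\<gamma> + \<beta>)) / of_nat (mon_fact \<gamma>))"

definition diff_op :: "'a::field_char_0 mpoly \<Rightarrow> 'a mpoly \<Rightarrow> 'a mpoly" where
  "diff_op g p = (\<Sum>\<beta>\<in>Poly_Mapping.keys g. smult_mp (Poly_Mapping.lookup g \<beta>) (pdiff_mon \<beta> p))"

definition inv_sys :: "nat \<Rightarrow> nat \<Rightarrow> 'a::field_char_0 mpoly \<Rightarrow> nat \<Rightarrow> 'a mpoly \<Rightarrow> 'a mpoly set" where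
  "inv_sys n d l k \<omega> = mspan {diff_op g (omega_dl n d l k \<omega>) | g. g \<in> Rpolys n}"

text \<open>An element of the dual is given by its values phi(x^alpha) on monomials and extended linearly.
  A power series in z is given by its coefficient function alpha -> coefficient of z^alpha;
  the identification sum phi_alpha z^alpha/alpha! <-> (x^alpha -> phi_alpha) is series_to_dual.\<close>

definition dual_app :: "(mon \<Rightarrow> 'a::field) \<Rightarrow> 'a mpoly \<Rightarrow> 'a" where
  "dual_app \<phi> p = (\<Sum>\<alpha>\<in>Poly_Mapping.keys p. Poly_Mapping.lookup p \<alpha> * \<phi> \<alpha>)"

definition series_to_dual :: "(mon \<Rightarrow> 'a::field) \<Rightarrow> (mon \<Rightarrow> 'a)" where
  "series_to_dual a \<alpha> = of_nat (mon_fact \<alpha>) * a \<alpha>"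

definition series_mult :: "(mon \<Rightarrow> 'a::field) \<Rightarrow> (mon \<Rightarrow> 'a) \<Rightarrow> (mon \<Rightarrow> 'a)" where
  "series_mult a b \<gamma> = (\<Sum>(\<alpha>,\<beta>)\<in>{(\<alpha>,\<beta>). \<alpha> + \<beta> = \<gamma>}. a \<alpha> * b \<beta>)"

definition poly_series :: "'a::field mpoly \<Rightarrow> (mon \<Rightarrow> 'a)" where
  "poly_series p = Poly_Mapping.lookup p"

text \<open>e_xi(z) = exp(xi_1 z_1 + ... + xi_n z_n)\<close>
definition exp_series :: "nat \<Rightarrow> (nat \<Rightarrow> 'a::field) \<Rightarrow> (mon \<Rightarrow> 'a)" where
  "exp_series n \<xi> \<alpha> = (if Poly_Mapping.keys \<alpha> \<subseteq> {1..n}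
      then (\<Prod>i\<in>Poly_Mapping.keys \<alpha>. \<xi> i ^ Poly_Mapping.lookup \<alpha> i / of_nat (fact (Poly_Mapping.lookup \<alpha> i) :: nat)) else 0)"

definition phi :: "nat \<Rightarrow> nat \<Rightarrow> nat \<Rightarrow> (nat \<Rightarrow> 'a::field mpoly) \<Rightarrow> (nat \<Rightarrow> nat)
    \<Rightarrow> (nat \<Rightarrow> nat \<Rightarrow> 'a) \<Rightarrow> (mon \<Rightarrow> 'a)" where
  "phi n d s \<omega> k \<xi> = series_to_dual (\<lambda>\<gamma>. \<Sum>i<s.
      series_mult (poly_series (omega_dl n d (lin_form n (\<xi> i)) (k i) (\<omega> i))) (exp_series n (\<xi> i)) \<gamma>)"

definition star :: "'a::field mpoly \<Rightarrow> (mon \<Rightarrow> 'a) \<Rightarrow> (mon \<Rightarrow> 'a)" where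
  "star p \<phi> = (\<lambda>\<alpha>. dual_app \<phi> (p * Poly_Mapping.single \<alpha> 1))"

definition Iphi :: "nat \<Rightarrow> (mon \<Rightarrow> 'a::field) \<Rightarrow> 'a mpoly set" where
  "Iphi n \<phi> = {p \<in> Rpolys n. \<forall>\<alpha>. Poly_Mapping.keys \<alpha> \<subseteq> {1..n} \<longrightarrow> star p \<phi> \<alpha> = 0}"

definition classes_basis :: "nat \<Rightarrow> 'a::field mpoly set \<Rightarrow> 'a mpoly set \<Rightarrow> bool" where
  "classes_basis n I B \<longleftrightarrow> B \<subseteq> Rpolys n \<and>
     (\<forall>F c. finite F \<and> F \<subseteq> B \<and> (\<Sum>b\<in>F. smult_mp (c b) b) \<in> I \<longrightarrow> (\<forall>b\<in>F. c b = 0)) \<and>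
     (\<forall>p\<in>Rpolys n. \<exists>q\<in>mspan B. p - q \<in> I)"

definition Bplus :: "nat \<Rightarrow> 'a::field mpoly set \<Rightarrow> 'a mpoly set" where
  "Bplus n B = B \<union> (\<Union>i\<in>{1..n}. (\<lambda>b. Var i * b) ` B)"

definition ideal_R :: "nat \<Rightarrow> 'a::field mpoly set \<Rightarrow> 'a mpoly set" where
  "ideal_R n G = {\<Sum>g\<in>F. r g * g | F r. finite F \<and> F \<subseteq> G \<and> (\<forall>g\<in>F. r g \<in> Rpolys n)}"

text \<open>f^* = (1/d!) f(z_0,...,z_n): x^alpha -> alpha! * coeff(f, alpha) / d!\<close>
definition fstar :: "nat \<Rightarrow> 'a::field mpoly \<Rightarrow> (mon \<Rightarrow> 'a)" where
  "fstar d f \<alpha> = Poly_Mapping.lookup f \<alpha> * of_nat (mon_fact \<alpha>) / of_nat (fact d :: nat)"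

text \<open>check f (x^alpha) = f^*(x_0^(d - |alpha|) x^alpha), for x^alpha in R_{<= d}; extended linearly by dual_app\<close>
definition fcheck :: "nat \<Rightarrow> 'a::field mpoly \<Rightarrow> (mon \<Rightarrow> 'a)" where
  "fcheck d f \<alpha> = fstar d f (\<alpha> + Poly_Mapping.single 0 (d - mon_deg \<alpha>))"

definition hankel :: "nat \<Rightarrow> 'a::field mpoly \<Rightarrow> 'a mpoly list \<Rightarrow> 'a mpoly list \<Rightarrow> 'a mat" where
  "hankel d f Q P = mat (length Q) (length P) (\<lambda>(i,j). dual_app (fcheck d f) (Q ! i * P ! j))"

definition hank_op :: "nat \<Rightarrow> 'a::field mpoly \<Rightarrow> 'a mpoly list \<Rightarrow> 'a mpoly \<Rightarrow> ('a mpoly \<Rightarrow> 'a)" where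
  "hank_op d f Q p = (\<lambda>q\<in>mspan (set Q). dual_app (fcheck d f) (p * q))"

definition hank_ker :: "nat \<Rightarrow> 'a::field mpoly \<Rightarrow> 'a mpoly list \<Rightarrow> 'a mpoly list \<Rightarrow> 'a mpoly set" where
  "hank_ker d f Q P = {p \<in> mspan (set P). hank_op d f Q p = (\<lambda>q\<in>mspan (set Q). 0)}"

definition hank_im :: "nat \<Rightarrow> 'a::field mpoly \<Rightarrow> 'a mpoly list \<Rightarrow> 'a mpoly list \<Rightarrow> ('a mpoly \<Rightarrow> 'a) set" where
  "hank_im d f Q P = hank_op d f Q ` mspan (set P)"

definition mult_matrix :: "'a::field mpoly set \<Rightarrow> 'a mpoly list \<Rightarrow> nat \<Rightarrow> 'a mat \<Rightarrow> bool" where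
  "mult_matrix I Bl i M \<longleftrightarrow> M \<in> carrier_mat (length Bl) (length Bl) \<and>
     (\<forall>j<length Bl. Var i * Bl ! j - (\<Sum>l<length Bl. smult_mp (M $$ (l, j)) (Bl ! l)) \<in> I)"

end

theory Submission
  imports Defs "HOL-Library.Function_Algebras"
begin

text \<open>
  By the multinomial theorem, \<open>\<phi>\<close> and the functional attached to \<open>f\<close> agree on polynomials of degree
  at most \<open>d\<close>, so every Hankel matrix in question may be computed with \<open>\<phi>\<close>. The bilinear form
  \<open>(p, q) \<mapsto> \<phi> (p q)\<close> is nondegenerate on \<open>R / I\<^sub>\<phi>\<close>, which settles the statements about \<open>H\<^sub>0\<close>, the rank,
  the multiplication matrices, the kernel and the image. Since \<open>1 \<in> B\<close> and the kernel contains a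
  reduction rule for every \<open>x\<^sub>i b\<close> with \<open>b \<in> B\<close>, it generates \<open>I\<^sub>\<phi>\<close>.

  For the dimension, \<open>R / I\<^sub>\<phi>\<close> is identified with the orbit \<open>R \<star> \<phi>\<close>. On a functional \<open>w e_\<xi>\<close>
  the variable \<open>x\<^sub>j\<close> acts as \<open>\<xi>\<^sub>j + \<partial>\<^sub>j\<close> on \<open>w\<close>, so the orbit of \<open>w e_\<xi>\<close> consists of the \<open>v e_\<xi>\<close> with \<open>v\<close> in
  the span of the derivatives of \<open>w\<close>, and polynomials vanishing at \<open>\<xi>\<close> act nilpotently. As the points \<open>\<xi>\<^sub>i\<close>
  are distinct, there are polynomials acting as the identity on one summand of \<open>\<phi>\<close> and as zero on the
  others, whence \<open>R \<star> \<phi>\<close> is the direct sum of the orbits of the summands.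
\<close>

section \<open>Polynomials, monomials and functionals\<close>

text \<open>The functional of \<open>f\<close> sees only monomials of degree \<open>d\<close>, while
  \<phi> is an infinite series. They are compared one summand \<open>w * l ^ (d - j)\<close> at a
  time, with \<open>w\<close> homogeneous of degree \<open>j\<close> in x_1, ..., x_n: up to degree
  \<open>d\<close> its functional is (d - j)! / d! times that of w e_\<xi>, and this is the origin
  of the weights in \<open>omega_dl\<close>. The same identity with d = k shows that a form has only
  one expansion in powers of l, so that the \<open>THE\<close> in \<open>omega_comps\<close> is
  justified.

  The second obstacle is to separate the points over a field that need not be algebraically closed.
  Neither evaluation nor primary decomposition is used: vanishing at \<xi> is expressed by lowering
  a degree filtration of functionals, and the projections are 1 - (1 - y)^M, where y acts on one
  summand as 1 plus a nilpotent operator and kills all others.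

  Finite dimension is not established separately; it is read off from the finite list
  \<open>B\<close>, and comparing \<open>B\<close> and \<open>B'\<close> with the orbit gives both
  the same length.\<close>

abbreviation unit_mon :: "nat \<Rightarrow> mon" where "unit_mon j \<equiv> Poly_Mapping.single j (Suc 0)"

lemma lookup_smult_mp [simp]: "Poly_Mapping.lookup (smult_mp c p) \<alpha> = c * Poly_Mapping.lookup p \<alpha>"
  unfolding smult_mp_def by (simp add: Poly_Mapping.map.rep_eq when_def)

lemma keys_smult_mp: "Poly_Mapping.keys (smult_mp c p) \<subseteq> Poly_Mapping.keys p"
  by (auto simp: in_keys_iff)

lemma smult_mp_mult_left: "smult_mp c p * q = smult_mp c (p * q)"
  unfolding smult_mp_def mult_map_scale_conv_mult by (simp add: mult.assoc)

lemma smult_mp_mult_right: "p * smult_mp c q = smult_mp c (p * q)"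
  by (metis mult.commute smult_mp_mult_left)

global_interpretation mp: Vector_Spaces.vector_space "smult_mp :: 'a::field \<Rightarrow> 'a mpoly \<Rightarrow> 'a mpoly"
  by unfold_locales (auto intro!: poly_mapping_eqI simp: lookup_add algebra_simps)

lemma mpoly_eq_sum_monomials:
  "p = (\<Sum>\<alpha>\<in>Poly_Mapping.keys p. smult_mp (Poly_Mapping.lookup p \<alpha>) (Poly_Mapping.single \<alpha> 1))"
  by (rule poly_mapping_eqI)
    (auto simp: lookup_sum lookup_single when_def in_keys_iff if_distrib cong: if_cong)

section \<open>Degrees and factorials of monomials\<close>

lemma mon_deg_superset:
  assumes "finite S" "Poly_Mapping.keys \<alpha> \<subseteq> S"
  shows "mon_deg \<alpha> = (\<Sum>i\<in>S. Poly_Mapping.lookup \<alpha> i)"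
  unfolding mon_deg_def by (rule sum.mono_neutral_left) (use assms in \<open>auto simp: in_keys_iff\<close>)

lemma mon_fact_superset:
  assumes "finite S" "Poly_Mapping.keys \<alpha> \<subseteq> S"
  shows "mon_fact \<alpha> = (\<Prod>i\<in>S. fact (Poly_Mapping.lookup \<alpha> i))"
  unfolding mon_fact_def by (rule prod.mono_neutral_left) (use assms in \<open>auto simp: in_keys_iff\<close>)

lemma keys_add_mon: "Poly_Mapping.keys (\<alpha> + \<beta> :: mon) = Poly_Mapping.keys \<alpha> \<union> Poly_Mapping.keys \<beta>"
  by (auto simp: in_keys_iff lookup_add)

lemma mon_deg_add: "mon_deg (\<alpha> + \<beta>) = mon_deg \<alpha> + mon_deg \<beta>"
  using mon_deg_superset[of "Poly_Mapping.keys \<alpha> \<union> Poly_Mapping.keys \<beta>"]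
  by (simp add: keys_add_mon lookup_add sum.distrib)

lemma mon_deg_0 [simp]: "mon_deg 0 = 0"
  by (simp add: mon_deg_def)

lemma mon_deg_single [simp]: "mon_deg (Poly_Mapping.single j m) = m"
  by (cases "m = 0") (auto simp: mon_deg_def)

lemma mon_deg_eq_0_iff [simp]: "mon_deg \<alpha> = 0 \<longleftrightarrow> \<alpha> = 0"
  by (auto simp: mon_deg_def in_keys_iff intro!: poly_mapping_eqI) 

lemma mon_fact_nonzero [simp]: "mon_fact \<alpha> \<noteq> 0"
  by (auto simp: mon_fact_def)

lemma mon_fact_unit: "mon_fact (\<gamma> + unit_mon j) = (Poly_Mapping.lookup \<gamma> j + 1) * mon_fact \<gamma>"
proof -
  let ?S = "insert j (Poly_Mapping.keys \<gamma>)"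
  have "mon_fact (\<gamma> + unit_mon j) = (\<Prod>i\<in>?S. fact (Poly_Mapping.lookup (\<gamma> + unit_mon j) i))"
    by (rule mon_fact_superset) (auto simp: keys_add_mon)
  also have "\<dots> = fact (Poly_Mapping.lookup \<gamma> j + 1) * (\<Prod>i\<in>?S - {j}. fact (Poly_Mapping.lookup \<gamma> i))"
    by (subst prod.remove[of _ j]) (auto simp: lookup_add lookup_single when_def intro!: prod.cong)
  also have "\<dots> = (Poly_Mapping.lookup \<gamma> j + 1) * (\<Prod>i\<in>?S. fact (Poly_Mapping.lookup \<gamma> i))"
    by (subst (2) prod.remove[of _ j]) (auto simp: algebra_simps)
  also have "(\<Prod>i\<in>?S. fact (Poly_Mapping.lookup \<gamma> i)) = mon_fact \<gamma>"
    by (rule mon_fact_superset[symmetric]) auto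
  finally show ?thesis .
qed

lemma mon_split:
  assumes "m \<le> Poly_Mapping.lookup (\<gamma>::mon) j"
  shows "\<gamma> = (\<gamma> - Poly_Mapping.single j m) + Poly_Mapping.single j m"
  using assms by (intro poly_mapping_eqI) (auto simp: lookup_add lookup_minus lookup_single when_def)

lemma mon_split_unit:
  assumes "Poly_Mapping.lookup (\<gamma>::mon) j \<noteq> 0"
  shows "\<gamma> = (\<gamma> - unit_mon j) + unit_mon j"
  using assms by (intro mon_split) simp

text \<open>Limiting the step to variables in \<open>S\<close> makes the rule fit claims that
  concern only monomials in x_1, ..., x_n or in x_0, ..., x_n.\<close>

lemma mon_induct [consumes 1, case_names zero add]:
  assumes "Poly_Mapping.keys \<gamma> \<subseteq> S" and "P 0"
    and "\<And>\<gamma> j. Poly_Mapping.keys \<gamma> \<subseteq> S \<Longrightarrow> j \<in> S \<Longrightarrow> P \<gamma> \<Longrightarrow> P (\<gamma> + unit_mon j)"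
  shows "P \<gamma>"
  using assms(1)
proof (induction "mon_deg \<gamma>" arbitrary: \<gamma>)
  case 0
  then show ?case using assms(2) by simp
next
  case (Suc m)
  then obtain j where j: "j \<in> Poly_Mapping.keys \<gamma>"
    by (metis keys_eq_empty equals0I mon_deg_0 old.nat.distinct(2))
  let ?\<gamma> = "\<gamma> - unit_mon j"
  have eq: "\<gamma> = ?\<gamma> + unit_mon j" using j by (intro mon_split_unit) (simp add: in_keys_iff)
  have "mon_deg \<gamma> = mon_deg ?\<gamma> + 1" by (subst eq) (simp add: mon_deg_add del: One_nat_def)
  moreover have "Poly_Mapping.keys ?\<gamma> \<subseteq> Poly_Mapping.keys \<gamma>" using keys_add_mon[of ?\<gamma> "unit_mon j"] eq by auto
  ultimately have "P (?\<gamma> + unit_mon j)" using Suc j by (intro assms(3)) auto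
  then show ?case using eq by simp
qed

text \<open>A sum over an infinite set defaults to 0, so \<open>series_mult\<close> is the Cauchy
  product only thanks to this finiteness. A pair with sum \<open>\<gamma> + unit_mon j\<close> has
  x_j in one of its components, and removing it there leaves a pair with sum \<gamma>.\<close>

lemma finite_mon_pairs: "finite {(\<alpha>, \<beta>). \<alpha> + \<beta> = (\<gamma>::mon)}"
proof (rule mon_induct[of \<gamma> UNIV])
  have "{(\<alpha>, \<beta>). \<alpha> + \<beta> = (0::mon)} \<subseteq> {(0, 0)}"
    by (auto simp flip: mon_deg_eq_0_iff simp: mon_deg_add)
  then show "finite {(\<alpha>, \<beta>). \<alpha> + \<beta> = (0::mon)}" using finite_subset by blast
next
  fix \<gamma> :: mon and j
  let ?X = "\<lambda>\<gamma>. {(\<alpha>, \<beta>). \<alpha> + \<beta> = (\<gamma>::mon)}"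
  assume fin: "finite (?X \<gamma>)"
  have "?X (\<gamma> + unit_mon j) \<subseteq> (\<lambda>(\<alpha>, \<beta>). (\<alpha> + unit_mon j, \<beta>)) ` ?X \<gamma> \<union> (\<lambda>(\<alpha>, \<beta>). (\<alpha>, \<beta> + unit_mon j)) ` ?X \<gamma>"
  proof clarify
    fix \<alpha> \<beta> :: mon
    assume eq: "\<alpha> + \<beta> = \<gamma> + unit_mon j" and n: "(\<alpha>, \<beta>) \<notin> (\<lambda>(\<alpha>, \<beta>). (\<alpha>, \<beta> + unit_mon j)) ` ?X \<gamma>"
    have "Poly_Mapping.lookup (\<alpha> + \<beta>) j \<noteq> 0" by (simp add: eq lookup_add)
    then consider "Poly_Mapping.lookup \<alpha> j \<noteq> 0" | "Poly_Mapping.lookup \<beta> j \<noteq> 0" by (auto simp: lookup_add)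
    then show "(\<alpha>, \<beta>) \<in> (\<lambda>(\<alpha>, \<beta>). (\<alpha> + unit_mon j, \<beta>)) ` ?X \<gamma>"
    proof cases
      case 1
      note s = mon_split_unit[OF 1]
      have "((\<alpha> - unit_mon j) + \<beta>) + unit_mon j = \<gamma> + unit_mon j"
        unfolding eq[symmetric] by (subst (2) s) (simp only: ac_simps)
      then have "(\<alpha> - unit_mon j) + \<beta> = \<gamma>" by (simp only: add_right_cancel)
      then show ?thesis using s by (intro image_eqI[of _ _ "(\<alpha> - unit_mon j, \<beta>)"]) auto
    next
      case 2
      note s = mon_split_unit[OF 2]
      have "(\<alpha> + (\<beta> - unit_mon j)) + unit_mon j = \<gamma> + unit_mon j"
        unfolding eq[symmetric] by (subst (2) s) (simp only: ac_simps)
      then have "\<alpha> + (\<beta> - unit_mon j) = \<gamma>" by (simp only: add_right_cancel)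
      then have "(\<alpha>, \<beta>) \<in> (\<lambda>(\<alpha>, \<beta>). (\<alpha>, \<beta> + unit_mon j)) ` ?X \<gamma>"
        using s by (intro image_eqI[of _ _ "(\<alpha>, \<beta> - unit_mon j)"]) auto
      then show ?thesis using n by blast
    qed
  qed
  then show "finite (?X (\<gamma> + unit_mon j))" using fin by (meson finite_UnI finite_imageI finite_subset)
qed simp

lemma lookup_mult_series: "Poly_Mapping.lookup (p * q) \<gamma> = series_mult (Poly_Mapping.lookup p) (Poly_Mapping.lookup q) \<gamma>"
proof -
  have "Poly_Mapping.lookup (p * q) \<gamma> = (\<Sum>(a, b). Poly_Mapping.lookup p a * Poly_Mapping.lookup q b when \<gamma> = a + b)"
    unfolding times_poly_mapping.rep_eq by (subst prod_fun_unfold_prod) auto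
  also have "\<dots> = (\<Sum>(\<alpha>,\<beta>)\<in>{(\<alpha>,\<beta>). \<alpha> + \<beta> = \<gamma>}. Poly_Mapping.lookup p \<alpha> * Poly_Mapping.lookup q \<beta> when \<gamma> = \<alpha> + \<beta>)"
    by (rule Sum_any.expand_superset) (auto simp: finite_mon_pairs)
  also have "\<dots> = series_mult (Poly_Mapping.lookup p) (Poly_Mapping.lookup q) \<gamma>"
    unfolding series_mult_def by (rule sum.cong) auto
  finally show ?thesis .
qed

section \<open>Spaces of polynomials in x_1, ..., x_n\<close>

lemma Rpolys_iff: "p \<in> Rpolys n \<longleftrightarrow> (\<forall>\<alpha>. Poly_Mapping.lookup p \<alpha> \<noteq> 0 \<longrightarrow> Poly_Mapping.keys \<alpha> \<subseteq> {1..n})"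
  by (auto simp: Rpolys_def in_keys_iff)

lemma subspace_Rpolys: "mp.subspace (Rpolys n)"
  unfolding mp.subspace_def by (auto simp: Rpolys_iff lookup_add)
    (metis add.right_neutral subsetD atLeastAtMost_iff)+

lemma Rpolys_mult:
  assumes "p \<in> Rpolys n" "q \<in> Rpolys n"
  shows "p * q \<in> Rpolys n"
proof -
  have "Poly_Mapping.keys (p * q) \<subseteq> {a + b |a b. a \<in> Poly_Mapping.keys p \<and> b \<in> Poly_Mapping.keys q}"
    by (rule keys_mult)
  then show ?thesis using assms unfolding Rpolys_def by (fastforce simp: keys_add_mon)
qed

lemma Rle_subset_Rpolys: "Rle n m \<subseteq> Rpolys n"
  by (auto simp: Rle_def)

lemma Rle_mult:
  assumes "p \<in> Rle n a" "q \<in> Rle n b"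
  shows "p * q \<in> Rle n (a + b)"
proof -
  have "Poly_Mapping.keys (p * q) \<subseteq> {a + b |a b. a \<in> Poly_Mapping.keys p \<and> b \<in> Poly_Mapping.keys q}"
    by (rule keys_mult)
  then show ?thesis using assms Rpolys_mult[of p n q] unfolding Rle_def
    by (fastforce simp: mon_deg_add intro: add_mono)
qed

lemma subspace_Rle: "mp.subspace (Rle n c)"
  using subspace_Rpolys[of n] unfolding mp.subspace_def Rle_def
  by (auto simp: in_keys_iff lookup_add)

lemma one_in_Rpolys: "1 \<in> Rpolys n"
  by (simp add: Rpolys_iff lookup_one when_def)

lemma monomial_in_Rpolys: "Poly_Mapping.keys \<alpha> \<subseteq> {1..n} \<Longrightarrow> Poly_Mapping.single \<alpha> c \<in> Rpolys n"
  by (auto simp: Rpolys_iff lookup_single when_def split: if_splits)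

lemma Var_in_Rpolys: "j \<in> {1..n} \<Longrightarrow> Var j \<in> Rpolys n"
  unfolding Var_def by (rule monomial_in_Rpolys) simp

lemma Rpolys_power: "p \<in> Rpolys n \<Longrightarrow> p ^ m \<in> Rpolys n"
  by (induction m) (auto intro: Rpolys_mult one_in_Rpolys)

lemma Var_mult_monomial: "Var j * Poly_Mapping.single \<gamma> c = Poly_Mapping.single (\<gamma> + unit_mon j) c"
  by (simp add: Var_def mult_single add.commute)

text \<open>R arises from 1 by multiplication with variables and linear combination. A claim about
  the action of all of R is thereby reduced to the action of a single variable.\<close>

lemma Rpolys_induct [consumes 1, case_names one Var add smult]:
  assumes "p \<in> Rpolys n" and one: "P 1"
    and Var: "\<And>j q. j \<in> {1..n} \<Longrightarrow> q \<in> Rpolys n \<Longrightarrow> P q \<Longrightarrow> P (Var j * q)"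
    and add: "\<And>p q. p \<in> Rpolys n \<Longrightarrow> q \<in> Rpolys n \<Longrightarrow> P p \<Longrightarrow> P q \<Longrightarrow> P (p + q)"
    and smult: "\<And>c q. q \<in> Rpolys n \<Longrightarrow> P q \<Longrightarrow> P (smult_mp c q)"
  shows "P p"
proof -
  have mon: "P (Poly_Mapping.single \<alpha> 1)" if "Poly_Mapping.keys \<alpha> \<subseteq> {1..n}" for \<alpha>
    using that
  proof (induction rule: mon_induct)
    case zero
    then show ?case using one by simp
  next
    case (add \<gamma> j)
    then show ?case using Var[of j "Poly_Mapping.single \<gamma> 1", OF _ monomial_in_Rpolys]
      by (simp add: Var_mult_monomial)
  qed
  have "(\<Sum>\<alpha>\<in>F. smult_mp (Poly_Mapping.lookup p \<alpha>) (Poly_Mapping.single \<alpha> 1)) \<in> Rpolys n \<and>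
     P (\<Sum>\<alpha>\<in>F. smult_mp (Poly_Mapping.lookup p \<alpha>) (Poly_Mapping.single \<alpha> 1))"
    if "finite F" "F \<subseteq> Poly_Mapping.keys p" for F
    using that
  proof induction
    case empty
    \<comment> \<open>The zero polynomial is reached as 0 times 1.\<close>
    then show ?case using smult[OF one_in_Rpolys one, of 0] mp.subspace_0[OF subspace_Rpolys] by simp
  next
    case (insert \<alpha> F)
    have "Poly_Mapping.keys \<alpha> \<subseteq> {1..n}" using insert.prems assms(1) by (auto simp: Rpolys_def)
    then have "smult_mp (Poly_Mapping.lookup p \<alpha>) (Poly_Mapping.single \<alpha> 1) \<in> Rpolys n"
       "P (smult_mp (Poly_Mapping.lookup p \<alpha>) (Poly_Mapping.single \<alpha> 1))"
      using mon smult monomial_in_Rpolys mp.subspace_scale[OF subspace_Rpolys] by blast+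
    then show ?case using insert add mp.subspace_add[OF subspace_Rpolys] by auto
  qed
  from this[of "Poly_Mapping.keys p"] mpoly_eq_sum_monomials[of p] show ?thesis by simp
qed

section \<open>Functionals and the action of R on them\<close>

lemma dual_app_superset:
  assumes "finite S" "Poly_Mapping.keys p \<subseteq> S"
  shows "dual_app \<phi> p = (\<Sum>\<alpha>\<in>S. Poly_Mapping.lookup p \<alpha> * \<phi> \<alpha>)"
  unfolding dual_app_def by (rule sum.mono_neutral_left) (use assms in \<open>auto simp: in_keys_iff\<close>)

lemma dual_app_add: "dual_app \<phi> (p + q) = dual_app \<phi> p + dual_app \<phi> q"
proof -
  let ?S = "Poly_Mapping.keys p \<union> Poly_Mapping.keys q"
  show ?thesis
    using dual_app_superset[of ?S p \<phi>] dual_app_superset[of ?S q \<phi>] dual_app_superset[of ?S "p + q" \<phi>]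
      Poly_Mapping.keys_add[of p q]
    by (simp add: lookup_add distrib_right sum.distrib)
qed

lemma dual_app_smult: "dual_app \<phi> (smult_mp c p) = c * dual_app \<phi> p"
  using dual_app_superset[OF finite_keys keys_smult_mp, of \<phi> c p]
  by (simp add: dual_app_def sum_distrib_left mult.assoc)

lemma dual_app_0 [simp]: "dual_app \<phi> 0 = 0"
  by (simp add: dual_app_def)

lemma dual_app_diff: "dual_app \<phi> (p - q) = dual_app \<phi> p - dual_app \<phi> q"
  by (metis add_diff_cancel diff_add_cancel dual_app_add)

lemma dual_app_sum: "dual_app \<phi> (\<Sum>x\<in>F. g x) = (\<Sum>x\<in>F. dual_app \<phi> (g x))"
  by (induction F rule: infinite_finite_induct) (auto simp: dual_app_add)

lemma dual_app_monomial [simp]: "dual_app \<phi> (Poly_Mapping.single \<alpha> c) = c * \<phi> \<alpha>"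
  by (simp add: dual_app_def)

text \<open>\<open>star p\<close> is the transpose of multiplication by \<open>p\<close>; its
  definition says so on monomials, and linearity extends it.\<close>

lemma dual_app_star: "dual_app (star p \<phi>) q = dual_app \<phi> (p * q)"
proof -
  have "dual_app \<phi> (p * q) =
    dual_app \<phi> (p * (\<Sum>\<alpha>\<in>Poly_Mapping.keys q. smult_mp (Poly_Mapping.lookup q \<alpha>) (Poly_Mapping.single \<alpha> 1)))"
    using mpoly_eq_sum_monomials[of q] by simp
  also have "\<dots> = dual_app (star p \<phi>) q"
    unfolding sum_distrib_left dual_app_sum smult_mp_mult_right dual_app_smult
    unfolding dual_app_def[of "star p \<phi>"] by (simp add: star_def)
  finally show ?thesis ..
qed

text \<open>Functionals get a vector space structure of their own, so that orbits under
  \<open>star\<close> have spans and dimensions.\<close>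

definition smult_fun :: "'a::field \<Rightarrow> (mon \<Rightarrow> 'a) \<Rightarrow> (mon \<Rightarrow> 'a)" where
  "smult_fun c \<phi> = (\<lambda>\<alpha>. c * \<phi> \<alpha>)"

global_interpretation fn: Vector_Spaces.vector_space "smult_fun :: 'a::field \<Rightarrow> (mon \<Rightarrow> 'a) \<Rightarrow> (mon \<Rightarrow> 'a)"
  by unfold_locales (auto simp: smult_fun_def fun_eq_iff algebra_simps)

global_interpretation mp_fn: vector_space_pair
  "smult_mp :: 'a::field \<Rightarrow> 'a mpoly \<Rightarrow> 'a mpoly" "smult_fun :: 'a::field \<Rightarrow> (mon \<Rightarrow> 'a) \<Rightarrow> (mon \<Rightarrow> 'a)" ..

lemma star_mult: "star (p * q) \<phi> = star p (star q \<phi>)"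
proof
  fix \<alpha>
  have "star p (star q \<phi>) \<alpha> = dual_app \<phi> (q * (p * Poly_Mapping.single \<alpha> 1))"
    by (simp add: star_def[of p] dual_app_star)
  then show "star (p * q) \<phi> \<alpha> = star p (star q \<phi>) \<alpha>"
    by (simp add: star_def[of "p * q"] ac_simps)
qed

lemma star_add: "star (p + q) \<phi> = star p \<phi> + star q \<phi>"
  by (simp add: star_def fun_eq_iff dual_app_add distrib_right)

lemma star_smult: "star (smult_mp c p) \<phi> = smult_fun c (star p \<phi>)"
  by (simp add: star_def fun_eq_iff dual_app_smult smult_mp_mult_left smult_fun_def)

lemma star_linear: "Vector_Spaces.linear smult_mp smult_fun (\<lambda>p. star p \<phi>)"
  by (simp add: Vector_Spaces.linear_iff star_add star_smult mp.vector_space_axioms fn.vector_space_axioms)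

lemma dual_app_fun_add: "dual_app (\<phi> + \<psi>) p = dual_app \<phi> p + dual_app \<psi> p"
  by (simp add: dual_app_def distrib_left sum.distrib)

lemma dual_app_fun_smult: "dual_app (smult_fun c \<phi>) p = c * dual_app \<phi> p"
  by (simp add: dual_app_def smult_fun_def sum_distrib_left ac_simps)

lemma star_fun_add: "star p (\<phi> + \<psi>) = star p \<phi> + star p \<psi>"
  by (simp add: star_def fun_eq_iff dual_app_fun_add)

lemma star_fun_smult: "star p (smult_fun c \<phi>) = smult_fun c (star p \<phi>)"
  by (simp add: star_def fun_eq_iff dual_app_fun_smult) (simp add: smult_fun_def)

lemma star_fun_0 [simp]: "star p 0 = 0"
  by (simp add: star_def fun_eq_iff dual_app_def)

lemma star_0 [simp]: "star 0 \<phi> = 0"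
  by (simp add: star_def fun_eq_iff)

lemma star_fun_sum: "star p (\<Sum>x\<in>F. g x) = (\<Sum>x\<in>F. star p (g x))"
  by (induction F rule: infinite_finite_induct)
    (simp_all only: sum.infinite sum.empty sum.insert star_fun_add star_fun_0 not_False_eq_True)

lemma star_one [simp]: "star 1 \<phi> = \<phi>"
  by (simp add: star_def fun_eq_iff)

lemma star_Var: "star (Var j) \<phi> \<alpha> = \<phi> (\<alpha> + unit_mon j)"
  by (simp add: star_def Var_mult_monomial)

section \<open>Polynomial-exponential functionals\<close>

text \<open>The index set is a parameter because the series occurs twice: over {1..n} as
  \<open>exp_series\<close>, and over {0..n} with \<xi>_0 = 1 in the multinomial coefficients of
  powers of \<open>lin_form\<close>.\<close>

definition mexp :: "nat set \<Rightarrow> (nat \<Rightarrow> 'a::field) \<Rightarrow> (mon \<Rightarrow> 'a)" where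
  "mexp S \<xi> \<alpha> = (if Poly_Mapping.keys \<alpha> \<subseteq> S
      then (\<Prod>i\<in>S. \<xi> i ^ Poly_Mapping.lookup \<alpha> i / of_nat (fact (Poly_Mapping.lookup \<alpha> i) :: nat)) else 0)"

lemma exp_series_conv_mexp: "exp_series n \<xi> = mexp {1..n} \<xi>"
proof
  fix \<alpha>
  have "(\<Prod>i\<in>Poly_Mapping.keys \<alpha>. \<xi> i ^ Poly_Mapping.lookup \<alpha> i / of_nat (fact (Poly_Mapping.lookup \<alpha> i) :: nat))
      = (\<Prod>i\<in>{1..n}. \<xi> i ^ Poly_Mapping.lookup \<alpha> i / of_nat (fact (Poly_Mapping.lookup \<alpha> i) :: nat))"
    if "Poly_Mapping.keys \<alpha> \<subseteq> {1..n}"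
    by (rule prod.mono_neutral_left) (use that in \<open>auto simp: in_keys_iff\<close>)
  then show "exp_series n \<xi> \<alpha> = mexp {1..n} \<xi> \<alpha>"
    by (simp add: exp_series_def mexp_def)
qed

lemma mexp_0 [simp]: "mexp S \<xi> 0 = 1"
  by (simp add: mexp_def)

text \<open>Raising the exponent of x_j by one multiplies the j-th factor by \<xi>_j / (\<gamma>_j +
  1). This is the differential equation \<partial>_j e_\<xi> = \<xi>_j e_\<xi>, coefficient by
  coefficient.\<close>

lemma mexp_unit:
  fixes \<xi> :: "nat \<Rightarrow> 'a::field_char_0"
  assumes "j \<in> S" "finite S"
  shows "of_nat (Poly_Mapping.lookup \<gamma> j + 1) * mexp S \<xi> (\<gamma> + unit_mon j) = \<xi> j * mexp S \<xi> \<gamma>"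
proof (cases "Poly_Mapping.keys \<gamma> \<subseteq> S")
  case True
  let ?g = "\<lambda>\<gamma> i. \<xi> i ^ Poly_Mapping.lookup \<gamma> i / of_nat (fact (Poly_Mapping.lookup \<gamma> i) :: nat)"
  have "Poly_Mapping.keys (\<gamma> + unit_mon j) \<subseteq> S" using True assms by (simp add: keys_add_mon)
  then have "mexp S \<xi> (\<gamma> + unit_mon j) = (\<Prod>i\<in>S. ?g (\<gamma> + unit_mon j) i)"
    by (simp add: mexp_def)
  also have "\<dots> = ?g (\<gamma> + unit_mon j) j * (\<Prod>i\<in>S - {j}. ?g (\<gamma> + unit_mon j) i)"
    by (rule prod.remove) (use assms in auto)
  also have "(\<Prod>i\<in>S - {j}. ?g (\<gamma> + unit_mon j) i) = (\<Prod>i\<in>S - {j}. ?g \<gamma> i)"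
    by (rule prod.cong) (auto simp: lookup_add lookup_single)
  finally have 1: "mexp S \<xi> (\<gamma> + unit_mon j) = ?g (\<gamma> + unit_mon j) j * (\<Prod>i\<in>S - {j}. ?g \<gamma> i)" .
  have "mexp S \<xi> \<gamma> = (\<Prod>i\<in>S. ?g \<gamma> i)" using True by (simp add: mexp_def)
  also have "\<dots> = ?g \<gamma> j * (\<Prod>i\<in>S - {j}. ?g \<gamma> i)"
    by (rule prod.remove) (use assms in auto)
  finally have 2: "mexp S \<xi> \<gamma> = ?g \<gamma> j * (\<Prod>i\<in>S - {j}. ?g \<gamma> i)" .
  have "of_nat (Suc m) * (x ^ Suc m / of_nat (fact (Suc m) :: nat)) = x * (x ^ m / of_nat (fact m :: nat))"
    for m and x :: 'a
    by (simp only: fact_Suc of_nat_mult of_nat_id power_Suc) (simp del: of_nat_Suc)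
  then have "of_nat (Poly_Mapping.lookup \<gamma> j + 1) * ?g (\<gamma> + unit_mon j) j = \<xi> j * ?g \<gamma> j"
    by (simp only: lookup_add lookup_single_eq Suc_eq_plus1[symmetric] add_Suc_right add_0_right)
  from arg_cong[OF this, of "\<lambda>x. x * (\<Prod>i\<in>S - {j}. ?g \<gamma> i)"]
  show ?thesis unfolding 1 2 by (simp only: mult.assoc)
next
  case False
  then show ?thesis by (simp add: mexp_def keys_add_mon)
qed

section \<open>Formal derivatives and the Leibniz rule\<close>

lemma series_mult_commute: "series_mult a b \<gamma> = series_mult b a \<gamma>"
  unfolding series_mult_def
  by (rule sum.reindex_bij_witness[of _ "\<lambda>(x, y). (y, x)" "\<lambda>(x, y). (y, x)"]) (auto simp: ac_simps)

definition series_deriv :: "nat \<Rightarrow> (mon \<Rightarrow> 'a::field) \<Rightarrow> mon \<Rightarrow> 'a" where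
  "series_deriv j a \<gamma> = of_nat (Poly_Mapping.lookup \<gamma> j + 1) * a (\<gamma> + unit_mon j)"

text \<open>Shifting the first component by \<open>unit_mon j\<close> re-indexes the sum; the pairs
  that are missed have exponent 0 at j there, so their weight is 0. In this form both halves of the
  Leibniz rule run over the same index set.\<close>

lemma series_mult_deriv_left:
  "series_mult (series_deriv j a) b \<gamma> =
    (\<Sum>(\<alpha>,\<beta>)\<in>{(\<alpha>,\<beta>). \<alpha> + \<beta> = \<gamma> + unit_mon j}. of_nat (Poly_Mapping.lookup \<alpha> j) * (a \<alpha> * b \<beta>))"
proof -
  let ?X = "{(\<alpha>,\<beta>). \<alpha> + \<beta> = \<gamma>}" and ?Y = "{(\<alpha>,\<beta>). \<alpha> + \<beta> = \<gamma> + unit_mon j}"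
  let ?f = "\<lambda>(\<alpha>,\<beta>). (\<alpha> + unit_mon j, \<beta> :: mon)"
  let ?h = "\<lambda>(\<alpha>,\<beta>). of_nat (Poly_Mapping.lookup \<alpha> j) * (a \<alpha> * b \<beta>)"
  have sub: "?f ` ?X \<subseteq> ?Y" by (auto simp: ac_simps)
  have "x \<in> ?f ` ?X" if "x \<in> ?Y" "?h x \<noteq> 0" for x
  proof -
    obtain \<alpha> \<beta> where x: "x = (\<alpha>, \<beta>)" by force
    with that have eq: "\<alpha> + \<beta> = \<gamma> + unit_mon j" and "Poly_Mapping.lookup \<alpha> j \<noteq> 0"
      by (auto simp del: of_nat_eq_0_iff intro!: gr0I)
    then have s: "\<alpha> = (\<alpha> - unit_mon j) + unit_mon j" by (intro mon_split_unit)
    have "((\<alpha> - unit_mon j) + \<beta>) + unit_mon j = \<gamma> + unit_mon j"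
      unfolding eq[symmetric] by (subst (2) s) (simp only: ac_simps)
    then have "(\<alpha> - unit_mon j) + \<beta> = \<gamma>" by (simp only: add_right_cancel)
    then show ?thesis unfolding x using s by (intro image_eqI[of _ _ "(\<alpha> - unit_mon j, \<beta>)"]) auto
  qed
  then have "sum ?h ?Y = sum ?h (?f ` ?X)"
    by (intro sum.mono_neutral_right finite_mon_pairs sub) blast
  also have "\<dots> = sum (?h \<circ> ?f) ?X"
    by (rule sum.reindex) (auto simp: inj_on_def)
  also have "\<dots> = series_mult (series_deriv j a) b \<gamma>"
    unfolding series_mult_def by (rule sum.cong) (auto simp: series_deriv_def lookup_add)
  finally show ?thesis ..
qed

lemma series_deriv_mult:
  "series_deriv j (series_mult a b) \<gamma> = series_mult (series_deriv j a) b \<gamma> + series_mult a (series_deriv j b) \<gamma>"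
proof -
  let ?Y = "{(\<alpha>,\<beta>). \<alpha> + \<beta> = \<gamma> + unit_mon j}"
  have "series_mult a (series_deriv j b) \<gamma> =
      (\<Sum>(\<alpha>,\<beta>)\<in>?Y. of_nat (Poly_Mapping.lookup \<alpha> j) * (b \<alpha> * a \<beta>))"
    unfolding series_mult_commute[of a] by (rule series_mult_deriv_left)
  also have "\<dots> = (\<Sum>(\<alpha>,\<beta>)\<in>?Y. of_nat (Poly_Mapping.lookup \<beta> j) * (a \<alpha> * b \<beta>))"
    by (rule sum.reindex_bij_witness[of _ "\<lambda>(x, y). (y, x)" "\<lambda>(x, y). (y, x)"]) (auto simp: ac_simps)
  finally have "series_mult (series_deriv j a) b \<gamma> + series_mult a (series_deriv j b) \<gamma> =
     (\<Sum>(\<alpha>,\<beta>)\<in>?Y. of_nat (Poly_Mapping.lookup (\<alpha> + \<beta>) j) * (a \<alpha> * b \<beta>))"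
    by (simp add: series_mult_deriv_left lookup_add distrib_right sum.distrib case_prod_unfold)
  \<comment> \<open>On this index set the exponents at j of both components add up to \<gamma>_j +
    1, the weight in the derivative of the product.\<close>
  also have "\<dots> = (\<Sum>(\<alpha>,\<beta>)\<in>?Y. of_nat (Poly_Mapping.lookup \<gamma> j + 1) * (a \<alpha> * b \<beta>))"
  proof (rule sum.cong[OF refl], clarify)
    fix \<alpha> \<beta> assume eq: "\<alpha> + \<beta> = \<gamma> + unit_mon j"
    show "of_nat (Poly_Mapping.lookup (\<alpha> + \<beta>) j) * (a \<alpha> * b \<beta>) = of_nat (Poly_Mapping.lookup \<gamma> j + 1) * (a \<alpha> * b \<beta>)"
      unfolding eq by (simp add: lookup_add)
  qed
  also have "\<dots> = series_deriv j (series_mult a b) \<gamma>"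
    by (simp only: series_deriv_def series_mult_def sum_distrib_left case_prod_unfold)
  finally show ?thesis ..
qed

text \<open>The functional that the paper writes as the series \<open>w(z) e_\<xi>(z)\<close>.\<close>

definition pexp :: "nat \<Rightarrow> (nat \<Rightarrow> 'a::field) \<Rightarrow> 'a mpoly \<Rightarrow> (mon \<Rightarrow> 'a)" where
  "pexp n \<xi> w = series_to_dual (series_mult (poly_series w) (exp_series n \<xi>))"

lemma series_mult_add_left: "series_mult (\<lambda>\<alpha>. a \<alpha> + b \<alpha>) c \<gamma> = series_mult a c \<gamma> + series_mult b c \<gamma>"
  by (simp add: series_mult_def distrib_right sum.distrib case_prod_unfold)

lemma series_mult_scale_left: "series_mult (\<lambda>\<alpha>. x * a \<alpha>) c \<gamma> = x * series_mult a c \<gamma>"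
  by (simp add: series_mult_def sum_distrib_left case_prod_unfold mult.assoc)

lemma pexp_apply: "pexp n \<xi> w \<gamma> = of_nat (mon_fact \<gamma>) * series_mult (Poly_Mapping.lookup w) (exp_series n \<xi>) \<gamma>"
  by (simp add: pexp_def series_to_dual_def poly_series_def)

lemma pexp_add: "pexp n \<xi> (v + w) = pexp n \<xi> v + pexp n \<xi> w"
  by (rule ext) (simp add: pexp_apply lookup_add[abs_def] series_mult_add_left distrib_left)

lemma pexp_smult: "pexp n \<xi> (smult_mp c w) = smult_fun c (pexp n \<xi> w)"
  by (rule ext) (simp add: pexp_apply smult_fun_def lookup_smult_mp[abs_def] series_mult_scale_left)

lemma pexp_linear: "Vector_Spaces.linear smult_mp smult_fun (pexp n \<xi>)"
  by (simp add: Vector_Spaces.linear_iff pexp_add pexp_smult mp.vector_space_axioms fn.vector_space_axioms)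

lemma pexp_0 [simp]: "pexp n \<xi> 0 = 0"
  using pexp_smult[of n \<xi> 0 0] by simp

text \<open>\<open>Abs_poly_mapping\<close> is meaningful only for finite support. Here the support
  lies in the preimage of \<open>keys p\<close> under an injective shift.\<close>

lemma lookup_pdiff_mon:
  "Poly_Mapping.lookup (pdiff_mon \<beta> p) \<gamma> =
     Poly_Mapping.lookup p (\<gamma> + \<beta>) * of_nat (mon_fact (\<gamma> + \<beta>)) / of_nat (mon_fact \<gamma>)"
proof -
  have "finite ((\<lambda>\<gamma>. \<gamma> + \<beta>) -` Poly_Mapping.keys p)"
    by (rule finite_vimageI) (auto simp: inj_on_def)
  then have "finite {\<gamma>. Poly_Mapping.lookup p (\<gamma> + \<beta>) * of_nat (mon_fact (\<gamma> + \<beta>)) / of_nat (mon_fact \<gamma>) \<noteq> 0}"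
    by (rule rev_finite_subset) (auto simp: in_keys_iff)
  then show ?thesis unfolding pdiff_mon_def by simp
qed

lemma lookup_pdiff_unit: "Poly_Mapping.lookup (pdiff_mon (unit_mon j) p) \<gamma> = series_deriv j (Poly_Mapping.lookup p) \<gamma>"
proof -
  have "of_nat (mon_fact (\<gamma> + unit_mon j)) = (of_nat (Poly_Mapping.lookup \<gamma> j + 1) * of_nat (mon_fact \<gamma>) :: 'a)"
    by (simp only: mon_fact_unit of_nat_mult)
  then show ?thesis unfolding lookup_pdiff_mon series_deriv_def
    by (simp del: of_nat_Suc of_nat_add)
qed

lemma pdiff_mon_0 [simp]: "pdiff_mon 0 p = p"
  by (rule poly_mapping_eqI) (simp add: lookup_pdiff_mon)

lemma pdiff_mon_add_mon: "pdiff_mon (\<alpha> + \<beta>) p = pdiff_mon \<alpha> (pdiff_mon \<beta> p)"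
  by (rule poly_mapping_eqI) (simp add: lookup_pdiff_mon add.assoc)

lemma pdiff_mon_add: "pdiff_mon \<beta> (p + q) = pdiff_mon \<beta> p + pdiff_mon \<beta> q"
  by (rule poly_mapping_eqI) (simp add: lookup_pdiff_mon lookup_add field_simps)

lemma pdiff_mon_smult: "pdiff_mon \<beta> (smult_mp c p) = smult_mp c (pdiff_mon \<beta> p)"
  by (rule poly_mapping_eqI) (simp add: lookup_pdiff_mon)

text \<open>In \<open>series_to_dual\<close> the factorial of the shifted monomial absorbs
  \<gamma>_j + 1, so x_j acts on functionals as \<partial>_j acts on series. The Leibniz rule and
  the differential equation of e_\<xi> do the rest.\<close>

lemma star_Var_pexp:
  assumes "j \<in> {1..n}"
  shows "star (Var j) (pexp n \<xi> w) = pexp n \<xi> (smult_mp (\<xi> j) w + pdiff_mon (unit_mon j) w)"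
proof
  fix \<gamma>
  let ?e = "exp_series n \<xi>"
  have de: "series_deriv j ?e = (\<lambda>\<gamma>. \<xi> j * ?e \<gamma>)"
    by (rule ext) (simp only: series_deriv_def exp_series_conv_mexp mexp_unit[OF assms finite_atLeastAtMost])
  have "star (Var j) (pexp n \<xi> w) \<gamma> = of_nat (mon_fact \<gamma>) * series_deriv j (series_mult (Poly_Mapping.lookup w) ?e) \<gamma>"
    by (simp only: star_Var pexp_apply mon_fact_unit series_deriv_def of_nat_mult ac_simps)
  also have "\<dots> = of_nat (mon_fact \<gamma>) * (series_mult (series_deriv j (Poly_Mapping.lookup w)) ?e \<gamma>
      + \<xi> j * series_mult (Poly_Mapping.lookup w) ?e \<gamma>)"
    by (simp only: series_deriv_mult de series_mult_commute[of "Poly_Mapping.lookup w"] series_mult_scale_left)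
  also have "\<dots> = pexp n \<xi> (smult_mp (\<xi> j) w + pdiff_mon (unit_mon j) w) \<gamma>"
    by (simp add: pexp_add pexp_smult pexp_apply smult_fun_def lookup_pdiff_unit[abs_def] distrib_left)
  finally show "star (Var j) (pexp n \<xi> w) \<gamma> = \<dots>" .
qed

text \<open>e_\<xi> has constant term 1, so the coefficient of w e_\<xi> at \<alpha> is that of
  \<open>w\<close> plus terms with coefficients of \<open>w\<close> in lower degree. The bound
  \<open>m\<close> serves the uniqueness of expansions, where the functional is known only up to
  some degree.\<close>

lemma pexp_eq_0_imp_lookup_eq_0:
  fixes w :: "'a::field_char_0 mpoly"
  assumes w: "w \<in> Rpolys n"
    and z: "\<And>\<alpha>. Poly_Mapping.keys \<alpha> \<subseteq> {1..n} \<Longrightarrow> mon_deg \<alpha> \<le> m \<Longrightarrow> pexp n \<xi> w \<alpha> = 0"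
    and "mon_deg \<alpha> \<le> m"
  shows "Poly_Mapping.lookup w \<alpha> = 0"
  using assms(3)
proof (induction "mon_deg \<alpha>" arbitrary: \<alpha> rule: less_induct)
  case less
  show ?case
  proof (cases "Poly_Mapping.keys \<alpha> \<subseteq> {1..n}")
    case True
    let ?h = "\<lambda>(\<beta>, \<gamma>). Poly_Mapping.lookup w \<beta> * exp_series n \<xi> \<gamma>"
    have "series_mult (Poly_Mapping.lookup w) (exp_series n \<xi>) \<alpha> = sum ?h {(\<alpha>, 0)}"
      unfolding series_mult_def
    proof (rule sum.mono_neutral_right[OF finite_mon_pairs])
      show "\<forall>i\<in>{(\<beta>, \<gamma>). \<beta> + \<gamma> = \<alpha>} - {(\<alpha>, 0)}. ?h i = 0"
      proof
        fix i assume i: "i \<in> {(\<beta>, \<gamma>). \<beta> + \<gamma> = \<alpha>} - {(\<alpha>, 0)}"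
        obtain \<beta> \<gamma> where [simp]: "i = (\<beta>, \<gamma>)" by force
        have eq: "\<alpha> = \<beta> + \<gamma>" and "\<gamma> \<noteq> 0" using i by auto
        then have "mon_deg \<beta> < mon_deg \<alpha>" using mon_deg_eq_0_iff[of \<gamma>] unfolding eq mon_deg_add by linarith
        then show "?h i = 0" using less by simp
      qed
    qed auto
    moreover have "pexp n \<xi> w \<alpha> = 0" using True less.prems by (rule z)
    ultimately show ?thesis by (simp add: pexp_apply exp_series_conv_mexp)
  next
    case False
    then show ?thesis using w by (auto simp: Rpolys_iff)
  qed
qed

lemma pexp_eq_0_imp_eq_0:
  fixes w :: "'a::field_char_0 mpoly"
  assumes "w \<in> Rpolys n" "pexp n \<xi> w = 0"
  shows "w = 0"
proof (rule poly_mapping_eqI)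
  fix \<alpha>
  have "Poly_Mapping.lookup w \<alpha> = 0"
    by (rule pexp_eq_0_imp_lookup_eq_0[OF assms(1) _ order_refl, where \<xi> = \<xi>]) (simp add: assms(2))
  then show "Poly_Mapping.lookup w \<alpha> = Poly_Mapping.lookup 0 \<alpha>" by simp
qed

section \<open>Generalized additive decompositions as truncated functionals\<close>

lemma lookup_Var_mult_add: "Poly_Mapping.lookup (Var j * p) (\<gamma> + unit_mon j) = Poly_Mapping.lookup p \<gamma>"
proof -
  have "Poly_Mapping.lookup (Var j * p) (\<gamma> + unit_mon j) =
     (\<Sum>(\<alpha>,\<beta>)\<in>{(unit_mon j, \<gamma>)}. Poly_Mapping.lookup (Var j) \<alpha> * Poly_Mapping.lookup p \<beta>)"
    unfolding lookup_mult_series series_mult_def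
    by (rule sum.mono_neutral_right[OF finite_mon_pairs])
      (auto simp: Var_def lookup_single when_def add.commute[of \<gamma> "unit_mon j"] split: if_splits)
  then show ?thesis by (simp add: Var_def)
qed

lemma lookup_Var_mult_eq_0:
  assumes "Poly_Mapping.lookup \<gamma> j = 0"
  shows "Poly_Mapping.lookup (Var j * p) \<gamma> = 0"
  unfolding lookup_mult_series series_mult_def
  by (rule sum.neutral) (use assms in \<open>auto simp: Var_def lookup_single when_def lookup_add\<close>)

lemma lin_form_conv_sum: "lin_form n \<xi> = (\<Sum>i\<in>{0..n}. smult_mp ((\<xi>(0 := 1)) i) (Var i))"
proof -
  have "(\<Sum>i\<in>{0..n}. smult_mp ((\<xi>(0 := 1)) i) (Var i)) =
      smult_mp 1 (Var 0) + (\<Sum>i\<in>{Suc 0..n}. smult_mp ((\<xi>(0 := 1)) i) (Var i))"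
    by (simp add: sum.atLeast_Suc_atMost)
  also have "(\<Sum>i\<in>{Suc 0..n}. smult_mp ((\<xi>(0 := 1)) i) (Var i)) = (\<Sum>j=1..n. smult_mp (\<xi> j) (Var j))"
    by (rule sum.cong) auto
  finally show ?thesis by (simp add: lin_form_def)
qed

text \<open>The multinomial theorem. In the step, the factor x_i contributes \<gamma>_i m! times the
  claimed series coefficient, and the weights \<gamma>_i add up to the degree m + 1. For \<gamma>
  with a variable beyond x_n, \<open>mexp\<close> vanishes.\<close>

lemma lookup_lin_form_power:
  fixes \<xi> :: "nat \<Rightarrow> 'a::field_char_0"
  shows "Poly_Mapping.lookup (lin_form n \<xi> ^ m) \<gamma> =
    (if mon_deg \<gamma> = m then of_nat (fact m :: nat) * mexp {0..n} (\<xi>(0 := 1)) \<gamma> else 0)"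
proof (induction m arbitrary: \<gamma>)
  case 0
  then show ?case by (auto simp: lookup_one when_def)
next
  case (Suc m)
  let ?g = "mexp {0..n} (\<xi>(0 := 1))" and ?l = "lin_form n \<xi>"
  have summand: "(\<xi>(0 := 1)) i * Poly_Mapping.lookup (Var i * ?l ^ m) \<gamma> =
      (if mon_deg \<gamma> = Suc m then of_nat (Poly_Mapping.lookup \<gamma> i) * (of_nat (fact m :: nat) * ?g \<gamma>) else 0)"
    if i: "i \<in> {0..n}" for i
  proof (cases "Poly_Mapping.lookup \<gamma> i = 0")
    case True
    then show ?thesis by (simp add: lookup_Var_mult_eq_0)
  next
    case False
    define \<delta> where "\<delta> = \<gamma> - unit_mon i"
    have \<gamma>: "\<gamma> = \<delta> + unit_mon i" unfolding \<delta>_def using mon_split_unit[OF False] .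
    have "(\<xi>(0 := 1)) i * ?g \<delta> = of_nat (Poly_Mapping.lookup \<gamma> i) * ?g \<gamma>"
      using mexp_unit[OF i finite_atLeastAtMost, of \<delta> "\<xi>(0 := 1)"] by (simp add: \<gamma> lookup_add)
    then show ?thesis
      by (simp add: \<gamma> lookup_Var_mult_add Suc.IH mon_deg_add lookup_add)
  qed
  have "Poly_Mapping.lookup (?l ^ Suc m) \<gamma> =
      (\<Sum>i\<in>{0..n}. (\<xi>(0 := 1)) i * Poly_Mapping.lookup (Var i * ?l ^ m) \<gamma>)"
    by (simp add: lin_form_conv_sum[of n \<xi>] sum_distrib_right lookup_sum smult_mp_mult_left)
  also have "\<dots> = (\<Sum>i\<in>{0..n}. if mon_deg \<gamma> = Suc m then of_nat (Poly_Mapping.lookup \<gamma> i) * (of_nat (fact m :: nat) * ?g \<gamma>) else 0)"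
    by (rule sum.cong[OF refl]) (rule summand)
  also have "\<dots> = (if mon_deg \<gamma> = Suc m then of_nat (\<Sum>i\<in>{0..n}. Poly_Mapping.lookup \<gamma> i) * (of_nat (fact m :: nat) * ?g \<gamma>) else 0)"
    by (simp add: sum_distrib_right)
  also have "\<dots> = (if mon_deg \<gamma> = Suc m then of_nat (fact (Suc m) :: nat) * ?g \<gamma> else 0)"
  proof (cases "Poly_Mapping.keys \<gamma> \<subseteq> {0..n}")
    case True
    then have "(\<Sum>i\<in>{0..n}. Poly_Mapping.lookup \<gamma> i) = mon_deg \<gamma>"
      by (intro mon_deg_superset[symmetric]) auto
    then show ?thesis by (simp only: fact_Suc of_nat_mult of_nat_id) (simp add: mult.assoc)
  next
    case False
    then show ?thesis by (simp add: mexp_def)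
  qed
  finally show ?case .
qed

lemma mexp_add_single_0:
  assumes "Poly_Mapping.keys \<gamma> \<subseteq> {1..n}"
  shows "mexp {0..n} (\<xi>(0 := 1)) (\<gamma> + Poly_Mapping.single 0 a) = exp_series n \<xi> \<gamma> / of_nat (fact a :: nat)"
proof -
  let ?g = "\<lambda>\<gamma> \<xi> i. \<xi> i ^ Poly_Mapping.lookup \<gamma> i / of_nat (fact (Poly_Mapping.lookup \<gamma> i) :: nat)"
  let ?\<delta> = "\<gamma> + Poly_Mapping.single 0 a" and ?\<zeta> = "\<xi>(0 := 1)"
  have g0: "Poly_Mapping.lookup \<gamma> 0 = 0" using assms by (metis atLeastAtMost_iff in_keys_iff not_one_le_zero subsetD)
  have "Poly_Mapping.keys ?\<delta> \<subseteq> {0..n}" using assms by (auto simp: keys_add_mon)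
  then have "mexp {0..n} ?\<zeta> ?\<delta> = (\<Prod>i\<in>{0..n}. ?g ?\<delta> ?\<zeta> i)" by (simp add: mexp_def)
  also have "\<dots> = ?g ?\<delta> ?\<zeta> 0 * (\<Prod>i\<in>{Suc 0..n}. ?g ?\<delta> ?\<zeta> i)"
    by (simp add: prod.atLeast_Suc_atMost)
  also have "(\<Prod>i\<in>{Suc 0..n}. ?g ?\<delta> ?\<zeta> i) = (\<Prod>i\<in>{1..n}. ?g \<gamma> \<xi> i)"
    by (rule prod.cong) (auto simp: lookup_add lookup_single)
  also have "\<dots> = exp_series n \<xi> \<gamma>" using assms by (simp add: exp_series_conv_mexp mexp_def)
  finally show ?thesis by (simp add: lookup_add g0 fun_upd_same del: fun_upd_apply)
qed

lemma mon_fact_add_single_0: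
  assumes "Poly_Mapping.lookup \<alpha> 0 = 0"
  shows "mon_fact (\<alpha> + Poly_Mapping.single 0 a) = mon_fact \<alpha> * fact a"
proof -
  let ?S = "insert 0 (Poly_Mapping.keys \<alpha>)"
  have *: "0 \<notin> Poly_Mapping.keys \<alpha>" using assms by (simp add: in_keys_iff)
  have "mon_fact (\<alpha> + Poly_Mapping.single 0 a) = (\<Prod>i\<in>?S. fact (Poly_Mapping.lookup (\<alpha> + Poly_Mapping.single 0 a) i))"
    by (rule mon_fact_superset) (auto simp: keys_add_mon split: if_splits)
  also have "\<dots> = fact a * (\<Prod>i\<in>Poly_Mapping.keys \<alpha>. fact (Poly_Mapping.lookup (\<alpha> + Poly_Mapping.single 0 a) i))"
    using * assms by (simp add: lookup_add)
  also have "(\<Prod>i\<in>Poly_Mapping.keys \<alpha>. fact (Poly_Mapping.lookup (\<alpha> + Poly_Mapping.single 0 a) i)) = mon_fact \<alpha>"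
    unfolding mon_fact_def by (rule prod.cong) (use * in \<open>auto simp: lookup_add lookup_single when_def\<close>)
  finally show ?thesis by simp
qed

text \<open>Since \<open>w\<close> is free of x_0, all of x_0^a in the target monomial comes from
  the power of l. Its multinomial coefficient carries 1 / a!, which cancels against the a! in the
  factorial of the homogenized monomial.\<close>

lemma fcheck_hom_mult_lin_form_power:
  fixes \<xi> :: "nat \<Rightarrow> 'a::field_char_0"
  assumes w: "w \<in> Rhom n j" and "j \<le> d"
    and \<alpha>: "Poly_Mapping.keys \<alpha> \<subseteq> {1..n}" "mon_deg \<alpha> \<le> d"
  shows "fcheck d (w * lin_form n \<xi> ^ (d - j)) \<alpha> =
    of_nat (fact (d - j) :: nat) / of_nat (fact d :: nat) * pexp n \<xi> w \<alpha>"
proof -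
  \<comment> \<open>The exponent of x_0 that homogenizes x^\<alpha> to degree
    \<open>d\<close>.\<close>
  define a where "a = d - mon_deg \<alpha>"
  let ?u = "Poly_Mapping.single (0::nat) a"
  let ?X = "{(\<beta>,\<gamma>). \<beta> + \<gamma> = \<alpha>}" and ?Y = "{(\<beta>,\<delta>). \<beta> + \<delta> = \<alpha> + ?u}"
  let ?f = "\<lambda>(\<beta>,\<gamma>). (\<beta> :: mon, \<gamma> + ?u)"
  let ?h = "\<lambda>(\<beta>,\<delta>). Poly_Mapping.lookup w \<beta> * Poly_Mapping.lookup (lin_form n \<xi> ^ (d - j)) \<delta>"
  let ?C = "of_nat (fact (d - j) :: nat) / of_nat (fact a :: nat) :: 'a"
  have keys0: "Poly_Mapping.lookup \<beta> 0 = 0" if "Poly_Mapping.keys \<beta> \<subseteq> {1..n}" for \<beta> :: mon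
    using that by (metis atLeastAtMost_iff in_keys_iff not_one_le_zero subsetD)
  have wk: "Poly_Mapping.keys \<beta> \<subseteq> {1..n}" "mon_deg \<beta> = j" if "Poly_Mapping.lookup w \<beta> \<noteq> 0" for \<beta>
    using w that by (auto simp: Rhom_def Rpolys_def in_keys_iff)
  have sub: "?f ` ?X \<subseteq> ?Y" by (auto simp: ac_simps)
  have "x \<in> ?f ` ?X" if "x \<in> ?Y" "?h x \<noteq> 0" for x
  proof -
    obtain \<beta> \<delta> where x: "x = (\<beta>, \<delta>)" by force
    with that have eq: "\<beta> + \<delta> = \<alpha> + ?u" and wb: "Poly_Mapping.lookup w \<beta> \<noteq> 0" by auto
    have "Poly_Mapping.lookup (\<beta> + \<delta>) 0 = a" unfolding eq using keys0[OF \<alpha>(1)] by (simp add: lookup_add)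
    then have "Poly_Mapping.lookup \<delta> 0 = a" using keys0[OF wk(1)[OF wb]] by (simp add: lookup_add)
    then have s: "\<delta> = (\<delta> - ?u) + ?u" by (intro mon_split) simp
    have "(\<beta> + (\<delta> - ?u)) + ?u = \<alpha> + ?u"
      unfolding eq[symmetric] by (subst (2) s) (simp only: ac_simps)
    then have "\<beta> + (\<delta> - ?u) = \<alpha>" by (simp only: add_right_cancel)
    then show ?thesis unfolding x using s by (intro image_eqI[of _ _ "(\<beta>, \<delta> - ?u)"]) auto
  qed
  then have "sum ?h ?Y = sum ?h (?f ` ?X)"
    by (intro sum.mono_neutral_right finite_mon_pairs sub) blast
  also have "\<dots> = sum (?h \<circ> ?f) ?X"
    by (rule sum.reindex) (auto simp: inj_on_def)
  also have "\<dots> = (\<Sum>(\<beta>,\<gamma>)\<in>?X. ?C * (Poly_Mapping.lookup w \<beta> * exp_series n \<xi> \<gamma>))"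
  proof (rule sum.cong[OF refl])
    fix x assume "x \<in> ?X"
    then obtain \<beta> \<gamma> where x: "x = (\<beta>, \<gamma>)" and eq: "\<alpha> = \<beta> + \<gamma>" by auto
    show "(?h \<circ> ?f) x = (case x of (\<beta>, \<gamma>) \<Rightarrow> ?C * (Poly_Mapping.lookup w \<beta> * exp_series n \<xi> \<gamma>))"
    proof (cases "Poly_Mapping.lookup w \<beta> = 0")
      case False
      then have "mon_deg \<beta> = j" by (rule wk)
      then have "mon_deg (\<gamma> + ?u) = d - j" using eq \<alpha>(2) by (simp add: mon_deg_add a_def)
      moreover have "Poly_Mapping.keys \<gamma> \<subseteq> {1..n}" using \<alpha>(1) eq by (simp add: keys_add_mon)
      ultimately show ?thesis by (simp add: x lookup_lin_form_power mexp_add_single_0)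
    qed (simp add: x)
  qed
  also have "\<dots> = ?C * series_mult (Poly_Mapping.lookup w) (exp_series n \<xi>) \<alpha>"
    by (simp only: series_mult_def sum_distrib_left case_prod_unfold)
  finally have "Poly_Mapping.lookup (w * lin_form n \<xi> ^ (d - j)) (\<alpha> + ?u) = ?C * series_mult (Poly_Mapping.lookup w) (exp_series n \<xi>) \<alpha>"
    by (simp add: lookup_mult_series series_mult_def)
  then show ?thesis
    unfolding fcheck_def fstar_def a_def[symmetric] pexp_apply mon_fact_add_single_0[OF keys0[OF \<alpha>(1)]]
    by simp
qed

lemma fcheck_sum: "fcheck d (\<Sum>i\<in>F. g i) \<alpha> = (\<Sum>i\<in>F. fcheck d (g i) \<alpha>)"
  by (simp add: fcheck_def fstar_def lookup_sum sum_distrib_right sum_divide_distrib)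

lemma pexp_sum: "pexp n \<xi> (\<Sum>i\<in>F. g i) \<alpha> = (\<Sum>i\<in>F. pexp n \<xi> (g i) \<alpha>)"
  by (induction F rule: infinite_finite_induct) (auto simp: pexp_add)

lemma fcheck_sum_lin_form_power:
  fixes \<xi> :: "nat \<Rightarrow> 'a::field_char_0"
  assumes "\<And>j. j \<le> k \<Longrightarrow> w j \<in> Rhom n j" and "k \<le> d"
    and \<alpha>: "Poly_Mapping.keys \<alpha> \<subseteq> {1..n}" "mon_deg \<alpha> \<le> d"
  shows "fcheck d (\<Sum>j\<le>k. w j * lin_form n \<xi> ^ (d - j)) \<alpha> =
    pexp n \<xi> (smult_mp (1 / of_nat (fact d :: nat)) (\<Sum>j\<le>k. smult_mp (of_nat (fact (d - j) :: nat)) (w j))) \<alpha>"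
proof -
  have "fcheck d (\<Sum>j\<le>k. w j * lin_form n \<xi> ^ (d - j)) \<alpha> =
    (\<Sum>j\<le>k. of_nat (fact (d - j) :: nat) / of_nat (fact d :: nat) * pexp n \<xi> (w j) \<alpha>)"
    unfolding fcheck_sum
    by (rule sum.cong[OF refl], rule fcheck_hom_mult_lin_form_power) (use assms in auto)
  then show ?thesis
    by (simp add: pexp_smult pexp_sum smult_fun_def sum_distrib_left)
qed

section \<open>Expansion of forms in powers of a linear form\<close>

lemma Rhom_subset_Rpolys: "Rhom n j \<subseteq> Rpolys n"
  by (auto simp: Rhom_def)

lemma subspace_Rhom: "mp.subspace (Rhom n j)"
  using subspace_Rpolys[of n] unfolding mp.subspace_def Rhom_def
  by (auto simp: in_keys_iff lookup_add)

lemma Rhom_mult: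
  assumes "p \<in> Rhom n i" "q \<in> Rhom n j"
  shows "p * q \<in> Rhom n (i + j)"
proof -
  have "Poly_Mapping.keys (p * q) \<subseteq> {a + b |a b. a \<in> Poly_Mapping.keys p \<and> b \<in> Poly_Mapping.keys q}"
    by (rule keys_mult)
  then show ?thesis using assms Rpolys_mult[of p n q] unfolding Rhom_def
    by (fastforce simp: mon_deg_add)
qed

lemma Var_in_Rhom: "j \<in> {1..n} \<Longrightarrow> Var j \<in> Rhom n 1"
  using Var_in_Rpolys[of j n] by (simp add: Rhom_def) (simp add: Var_def)

text \<open>The predicate under the \<open>THE\<close> of \<open>omega_comps\<close>, named so that
  existence and uniqueness can be proved for it.\<close>

definition lin_form_expansion :: "nat \<Rightarrow> 'a::field mpoly \<Rightarrow> nat \<Rightarrow> 'a mpoly \<Rightarrow> (nat \<Rightarrow> 'a mpoly) \<Rightarrow> bool" where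
  "lin_form_expansion n l k \<omega> w \<longleftrightarrow>
     (\<forall>j. w j \<in> Rhom n j) \<and> (\<forall>j>k. w j = 0) \<and> \<omega> = (\<Sum>j\<le>k. w j * l ^ (k - j))"

text \<open>A factor l raises the exponent of l and leaves every w_j at its index; a linear form
  \<open>p\<close> free of x_0 raises the degree of w_j and so shifts the index by one. Every
  variable is a combination of the two kinds.\<close>

lemma lin_form_expansion_mult:
  assumes w: "lin_form_expansion n l k \<omega> w" and p: "p \<in> Rhom n 1"
  shows "lin_form_expansion n l (Suc k) ((smult_mp c l + p) * \<omega>)
    (\<lambda>j. smult_mp c (w j) + (case j of 0 \<Rightarrow> 0 | Suc i \<Rightarrow> p * w i))"
  unfolding lin_form_expansion_def
proof (intro conjI allI impI)
  have hom: "w j \<in> Rhom n j" for j using w by (simp add: lin_form_expansion_def)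
  show "smult_mp c (w j) + (case j of 0 \<Rightarrow> 0 | Suc i \<Rightarrow> p * w i) \<in> Rhom n j" for j
    using mp.subspace_scale[OF subspace_Rhom hom] Rhom_mult[OF p hom]
    by (auto split: nat.split intro!: mp.subspace_add[OF subspace_Rhom])
  show "smult_mp c (w j) + (case j of 0 \<Rightarrow> 0 | Suc i \<Rightarrow> p * w i) = 0" if "j > Suc k" for j
    using w that by (auto simp: lin_form_expansion_def split: nat.split)
  have "(\<Sum>j\<le>Suc k. (smult_mp c (w j) + (case j of 0 \<Rightarrow> 0 | Suc i \<Rightarrow> p * w i)) * l ^ (Suc k - j))
     = (\<Sum>j\<le>Suc k. smult_mp c (w j) * l ^ (Suc k - j)) + (\<Sum>j\<le>Suc k. (case j of 0 \<Rightarrow> 0 | Suc i \<Rightarrow> p * w i) * l ^ (Suc k - j))"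
    by (simp only: distrib_right sum.distrib)
  also have "(\<Sum>j\<le>Suc k. smult_mp c (w j) * l ^ (Suc k - j)) = (\<Sum>j\<le>k. smult_mp c l * (w j * l ^ (k - j)))"
    using w by (simp add: lin_form_expansion_def Suc_diff_le smult_mp_mult_left)
      (simp add: smult_mp_mult_right ac_simps)
  also have "(\<Sum>j\<le>Suc k. (case j of 0 \<Rightarrow> 0 | Suc i \<Rightarrow> p * w i) * l ^ (Suc k - j)) = (\<Sum>j\<le>k. p * (w j * l ^ (k - j)))"
    by (subst sum.atMost_Suc_shift) (simp add: mult.assoc)
  finally show "(smult_mp c l + p) * \<omega> = (\<Sum>j\<le>Suc k. (smult_mp c (w j) + (case j of 0 \<Rightarrow> 0 | Suc i \<Rightarrow> p * w i)) * l ^ (Suc k - j))"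
    using w by (simp add: lin_form_expansion_def sum_distrib_left distrib_right)
qed

lemma lin_form_expansion_exists_monomial:
  assumes "Poly_Mapping.keys \<gamma> \<subseteq> {0..n}"
  shows "\<exists>w. lin_form_expansion n (lin_form n \<xi>) (mon_deg \<gamma>) (Poly_Mapping.single \<gamma> 1) w"
  using assms
proof (induction rule: mon_induct)
  case zero
  have "lin_form_expansion n (lin_form n \<xi>) 0 1 (\<lambda>j. if j = 0 then 1 else 0)"
    using mp.subspace_0[OF subspace_Rhom] by (auto simp: lin_form_expansion_def Rhom_def one_in_Rpolys)
  then show ?case by auto
next
  case (add \<gamma> j)
  then obtain w where w: "lin_form_expansion n (lin_form n \<xi>) (mon_deg \<gamma>) (Poly_Mapping.single \<gamma> 1) w" by blast
  have "\<exists>c p. p \<in> Rhom n 1 \<and> Var j = smult_mp c (lin_form n \<xi>) + p"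
  proof (cases "j = 0")
    case True
    \<comment> \<open>This is x_0 - l, so that x_0 becomes l plus a linear form free of x_0.\<close>
    let ?p = "- (\<Sum>j=1..n. smult_mp (\<xi> j) (Var j))"
    have "?p \<in> Rhom n 1"
      by (intro mp.subspace_neg[OF subspace_Rhom] mp.subspace_sum[OF subspace_Rhom]
          mp.subspace_scale[OF subspace_Rhom] Var_in_Rhom)
    moreover have "Var j = smult_mp 1 (lin_form n \<xi>) + ?p" using True by (simp add: lin_form_def)
    ultimately show ?thesis by blast
  next
    case False
    then have "Var j \<in> Rhom n 1" using add by (intro Var_in_Rhom) auto
    then show ?thesis by (intro exI[of _ 0] exI[of _ "Var j"]) simp
  qed
  then obtain c p where p: "p \<in> Rhom n 1" "Var j = smult_mp c (lin_form n \<xi>) + p" by blast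
  have eq: "Poly_Mapping.single (\<gamma> + unit_mon j) 1 = (smult_mp c (lin_form n \<xi>) + p) * Poly_Mapping.single \<gamma> 1"
    unfolding p(2)[symmetric] by (simp add: Var_mult_monomial)
  show ?case unfolding eq using lin_form_expansion_mult[OF w p(1), of c] by (auto simp: mon_deg_add)
qed

lemma lin_form_expansion_add:
  assumes "lin_form_expansion n l k \<omega> w" "lin_form_expansion n l k \<omega>' w'"
  shows "lin_form_expansion n l k (\<omega> + \<omega>') (\<lambda>j. w j + w' j)"
  using assms unfolding lin_form_expansion_def
  by (auto simp: distrib_right sum.distrib intro: mp.subspace_add[OF subspace_Rhom])

lemma lin_form_expansion_smult:
  assumes "lin_form_expansion n l k \<omega> w"
  shows "lin_form_expansion n l k (smult_mp c \<omega>) (\<lambda>j. smult_mp c (w j))"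
  using assms unfolding lin_form_expansion_def
  by (auto simp: smult_mp_mult_left mp.scale_sum_right intro: mp.subspace_scale[OF subspace_Rhom])

lemma lin_form_expansion_exists:
  assumes "\<omega> \<in> Shom n k"
  shows "\<exists>w. lin_form_expansion n (lin_form n \<xi>) k \<omega> w"
proof -
  have "\<exists>w. lin_form_expansion n (lin_form n \<xi>) k (\<Sum>\<alpha>\<in>F. smult_mp (Poly_Mapping.lookup \<omega> \<alpha>) (Poly_Mapping.single \<alpha> 1)) w"
    if "finite F" "F \<subseteq> Poly_Mapping.keys \<omega>" for F
    using that
  proof induction
    case empty
    have "lin_form_expansion n (lin_form n \<xi>) k 0 (\<lambda>j. 0)"
      by (auto simp: lin_form_expansion_def mp.subspace_0[OF subspace_Rhom])
    then show ?case by auto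
  next
    case (insert \<alpha> F)
    have "Poly_Mapping.keys \<alpha> \<subseteq> {0..n}" "mon_deg \<alpha> = k" using insert.prems assms by (auto simp: Shom_def)
    then obtain w where "lin_form_expansion n (lin_form n \<xi>) k (Poly_Mapping.single \<alpha> 1) w"
      using lin_form_expansion_exists_monomial by blast
    moreover obtain w' where "lin_form_expansion n (lin_form n \<xi>) k
      (\<Sum>\<alpha>\<in>F. smult_mp (Poly_Mapping.lookup \<omega> \<alpha>) (Poly_Mapping.single \<alpha> 1)) w'"
      using insert by auto
    ultimately show ?case
      using lin_form_expansion_add[OF lin_form_expansion_smult] insert(1,2) by (simp add: sum.insert) blast
  qed
  from this[of "Poly_Mapping.keys \<omega>"] mpoly_eq_sum_monomials[of \<omega>] show ?thesis by simp
qed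

text \<open>With d = k, the zero form has zero functional, so the polynomial \<open>W\<close> built
  from the w_j has no coefficients up to degree k. The w_j have different degrees and therefore
  occupy different coefficients of \<open>W\<close>, with nonzero weights (k - j)! / k!.\<close>

lemma lin_form_expansion_zero_unique:
  fixes \<xi> :: "nat \<Rightarrow> 'a::field_char_0"
  assumes "lin_form_expansion n (lin_form n \<xi>) k 0 w"
  shows "w = (\<lambda>j. 0)"
proof (rule ext, rule poly_mapping_eqI)
  fix j \<alpha>
  have hom: "w j \<in> Rhom n j" for j using assms by (simp add: lin_form_expansion_def)
  \<comment> \<open>The polynomial of \<open>omega_dl\<close> for d = k, with \<open>w\<close> in
    place of the components.\<close>
  define W where "W = smult_mp (1 / of_nat (fact k :: nat)) (\<Sum>j\<le>k. smult_mp (of_nat (fact (k - j) :: nat)) (w j))"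
  have W: "W \<in> Rpolys n" unfolding W_def using hom Rhom_subset_Rpolys
    by (intro mp.subspace_scale[OF subspace_Rpolys] mp.subspace_sum[OF subspace_Rpolys]) auto
  have "pexp n \<xi> W \<beta> = 0" if "Poly_Mapping.keys \<beta> \<subseteq> {1..n}" "mon_deg \<beta> \<le> k" for \<beta>
    unfolding W_def using fcheck_sum_lin_form_power[of k w n k \<beta> \<xi>] hom that assms
    by (simp add: lin_form_expansion_def fcheck_def fstar_def)
  then have W0: "Poly_Mapping.lookup W \<beta> = 0" if "mon_deg \<beta> \<le> k" for \<beta>
    using pexp_eq_0_imp_lookup_eq_0[OF W _ that] by blast
  have other: "Poly_Mapping.lookup (w i) \<beta> = 0" if "mon_deg \<beta> \<noteq> i" for i \<beta>
    using hom[of i] that by (auto simp: Rhom_def in_keys_iff)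
  show "Poly_Mapping.lookup (w j) \<alpha> = Poly_Mapping.lookup 0 \<alpha>"
  proof (cases "j \<le> k \<and> mon_deg \<alpha> = j")
    case True
    have "0 = Poly_Mapping.lookup W \<alpha>" using W0 True by simp
    also have "\<dots> = (\<Sum>i\<le>k. of_nat (fact (k - i) :: nat) * Poly_Mapping.lookup (w i) \<alpha>) / of_nat (fact k :: nat)"
      by (simp add: W_def lookup_sum)
    also have "(\<Sum>i\<le>k. of_nat (fact (k - i) :: nat) * Poly_Mapping.lookup (w i) \<alpha>) =
       (\<Sum>i\<in>{j}. of_nat (fact (k - i) :: nat) * Poly_Mapping.lookup (w i) \<alpha>)"
      by (rule sum.mono_neutral_right) (use True other in auto)
    finally show ?thesis by simp
  next
    case False
    then show ?thesis using assms other by (auto simp: lin_form_expansion_def)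
  qed
qed

lemma lin_form_expansion_omega_comps:
  fixes \<xi> :: "nat \<Rightarrow> 'a::field_char_0"
  assumes "\<omega> \<in> Shom n k"
  shows "lin_form_expansion n (lin_form n \<xi>) k \<omega> (omega_comps n (lin_form n \<xi>) k \<omega>)"
proof -
  have "w = w'" if "lin_form_expansion n (lin_form n \<xi>) k \<omega> w" "lin_form_expansion n (lin_form n \<xi>) k \<omega> w'" for w w'
  proof -
    have "lin_form_expansion n (lin_form n \<xi>) k 0 (\<lambda>j. w j + smult_mp (-1) (w' j))"
      using lin_form_expansion_add[OF that(1) lin_form_expansion_smult[OF that(2), of "-1"]] by simp
    from lin_form_expansion_zero_unique[OF this] show ?thesis by (auto simp: fun_eq_iff)
  qed
  then have "\<exists>!w. lin_form_expansion n (lin_form n \<xi>) k \<omega> w"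
    using lin_form_expansion_exists[OF assms] by blast
  then show ?thesis unfolding omega_comps_def lin_form_expansion_def[symmetric] by (rule theI')
qed

section \<open>Comparison of the functional of f with \<phi>\<close>

lemma omega_dl_in_Rpolys:
  fixes \<xi> :: "nat \<Rightarrow> 'a::field_char_0"
  assumes "\<omega> \<in> Shom n k"
  shows "omega_dl n d (lin_form n \<xi>) k \<omega> \<in> Rpolys n"
  unfolding omega_dl_def using lin_form_expansion_omega_comps[OF assms, of \<xi>]
  by (intro mp.subspace_scale[OF subspace_Rpolys] mp.subspace_sum[OF subspace_Rpolys] subsetD[OF Rhom_subset_Rpolys])
    (unfold lin_form_expansion_def, blast)

lemma fcheck_mult_lin_form_power:
  fixes \<xi> :: "nat \<Rightarrow> 'a::field_char_0"
  assumes \<omega>: "\<omega> \<in> Shom n k" and k: "k \<le> d" and "Poly_Mapping.keys \<alpha> \<subseteq> {1..n}" "mon_deg \<alpha> \<le> d"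
  shows "fcheck d (\<omega> * lin_form n \<xi> ^ (d - k)) \<alpha> = pexp n \<xi> (omega_dl n d (lin_form n \<xi>) k \<omega>) \<alpha>"
proof -
  let ?l = "lin_form n \<xi>" and ?w = "omega_comps n (lin_form n \<xi>) k \<omega>"
  note w = lin_form_expansion_omega_comps[OF \<omega>, of \<xi>]
  have "\<omega> * ?l ^ (d - k) = (\<Sum>j\<le>k. ?w j * (?l ^ (k - j) * ?l ^ (d - k)))"
    by (subst (1) w[unfolded lin_form_expansion_def, THEN conjunct2, THEN conjunct2])
      (simp add: sum_distrib_right mult.assoc)
  also have "\<dots> = (\<Sum>j\<le>k. ?w j * ?l ^ (d - j))"
    by (rule sum.cong) (use k in \<open>auto simp: power_add[symmetric]\<close>)
  finally show ?thesis
    using fcheck_sum_lin_form_power[of k ?w n d \<alpha> \<xi>] w assms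
    by (simp add: lin_form_expansion_def omega_dl_def)
qed

lemma phi_eq_sum_pexp:
  "phi n d s \<omega> k \<xi> \<alpha> = (\<Sum>i<s. pexp n (\<xi> i) (omega_dl n d (lin_form n (\<xi> i)) (k i) (\<omega> i)) \<alpha>)"
  by (simp add: phi_def series_to_dual_def pexp_def sum_distrib_left)

lemma fcheck_eq_phi:
  fixes f :: "'a::field_char_0 mpoly"
  assumes "is_GAD n d f s \<omega> k \<xi>" "Poly_Mapping.keys \<alpha> \<subseteq> {1..n}" "mon_deg \<alpha> \<le> d"
  shows "fcheck d f \<alpha> = phi n d s \<omega> k \<xi> \<alpha>"
proof -
  have "fcheck d f \<alpha> = (\<Sum>i<s. fcheck d (\<omega> i * lin_form n (\<xi> i) ^ (d - k i)) \<alpha>)"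
    using assms(1) by (simp add: is_GAD_def fcheck_sum)
  also have "\<dots> = phi n d s \<omega> k \<xi> \<alpha>" unfolding phi_eq_sum_pexp
    by (rule sum.cong[OF refl], rule fcheck_mult_lin_form_power) (use assms in \<open>auto simp: is_GAD_def\<close>)
  finally show ?thesis .
qed

section \<open>Orbits and inverse systems\<close>

text \<open>Directness is witnessed by maps \<pi>_i that are the identity on the i-th space and zero
  on the others; this is the form in which the separating polynomials act. The finite set
  \<open>F\<close> bounds the bases of the summands.\<close>

lemma (in Vector_Spaces.vector_space) dim_direct_sum:
  assumes I: "finite I"
    and W: "\<And>i. i \<in> I \<Longrightarrow> W i \<subseteq> V"
    and V: "\<And>v. v \<in> V \<Longrightarrow> v \<in> span (\<Union>i\<in>I. W i)"
    and F: "finite F" "V \<subseteq> span F"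
    and lin: "\<And>i. i \<in> I \<Longrightarrow> Vector_Spaces.linear scale scale (\<pi> i)"
    and id: "\<And>i x. i \<in> I \<Longrightarrow> x \<in> W i \<Longrightarrow> \<pi> i x = x"
    and ann: "\<And>i j x. i \<in> I \<Longrightarrow> j \<in> I \<Longrightarrow> i \<noteq> j \<Longrightarrow> x \<in> W j \<Longrightarrow> \<pi> i x = 0"
  shows "dim V = (\<Sum>i\<in>I. dim (W i))"
proof -
  have "\<exists>B. B \<subseteq> W i \<and> independent B \<and> W i \<subseteq> span B \<and> card B = dim (W i)" for i
    using basis_exists[of "W i"] by metis
  then obtain B where B: "\<And>i. B i \<subseteq> W i" "\<And>i. independent (B i)" "\<And>i. W i \<subseteq> span (B i)"
    "\<And>i. card (B i) = dim (W i)" by metis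
  have fin: "finite (B i)" if "i \<in> I" for i
    using independent_span_bound[OF F(1) B(2)[of i]] B(1)[of i] W[OF that] F(2) by blast
  let ?C = "\<Union>i\<in>I. B i"
  have disj: "B i \<inter> B j = {}" if "i \<in> I" "j \<in> I" "i \<noteq> j" for i j
  proof (rule ccontr)
    assume "B i \<inter> B j \<noteq> {}"
    then obtain x where x: "x \<in> B i" "x \<in> B j" by blast
    \<comment> \<open>\<pi>_i fixes x as an element of \<open>W i\<close> and kills it as an element
      of \<open>W j\<close>.\<close>
    then have "x = 0" using id[OF that(1), of x] ann[OF that, of x] B(1)[of i] B(1)[of j] by (metis subsetD)
    then show False using x B(2)[of i] dependent_zero by blast
  qed
  have "independent ?C"
  proof (rule independent_if_scalars_zero)
    show "finite ?C" using I fin by blast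
  next
    fix u x assume sum: "(\<Sum>x\<in>?C. u x *s x) = 0" and "x \<in> ?C"
    then obtain i where i: "i \<in> I" "x \<in> B i" by blast
    interpret l: Vector_Spaces.linear scale scale "\<pi> i" using lin[OF i(1)] .
    \<comment> \<open>Applying \<pi>_i erases all terms of the relation outside
      \<open>B i\<close>.\<close>
    have "0 = \<pi> i (\<Sum>x\<in>?C. u x *s x)" using sum l.zero by simp
    also have "\<dots> = (\<Sum>x\<in>?C. u x *s \<pi> i x)" by (simp add: l.sum l.scale)
    also have "\<dots> = (\<Sum>x\<in>B i. u x *s x)"
    proof (rule sum.mono_neutral_cong_right)
      show "finite ?C" using I fin by blast
      show "\<forall>x\<in>?C - B i. u x *s \<pi> i x = 0" using ann[OF i(1)] B(1) by fastforce
      show "u x *s \<pi> i x = u x *s x" if "x \<in> B i" for x using id[OF i(1)] B(1) that by auto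
    qed (use i in auto)
    finally show "u x = 0" using independentD[OF B(2)[of i] fin[OF i(1)] order_refl] i(2) by metis
  qed
  moreover have "V \<subseteq> span ?C"
  proof
    fix v assume "v \<in> V"
    moreover have "(\<Union>i\<in>I. W i) \<subseteq> span ?C" using B(3) span_mono[of "B _" ?C] by blast
    ultimately show "v \<in> span ?C" using V span_minimal[OF _ subspace_span] by blast
  qed
  moreover have "?C \<subseteq> V" using B(1) W by blast
  ultimately have "dim V = card ?C" using basis_card_eq_dim by metis
  also have "\<dots> = (\<Sum>i\<in>I. card (B i))" using I fin disj by (intro card_UN_disjoint) auto
  finally show ?thesis by (simp add: B(4))
qed

lemma (in vector_space_pair) dim_image_inj_on:
  assumes f: "Vector_Spaces.linear s1 s2 f" and D: "vs1.subspace D" and inj: "inj_on f D"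
  shows "vs2.dim (f ` D) = vs1.dim D"
proof -
  obtain B where B: "B \<subseteq> D" "vs1.independent B" "D \<subseteq> vs1.span B" "card B = vs1.dim D"
    using vs1.basis_exists .
  have sp: "vs1.span B = D" using vs1.span_minimal[OF B(1) D] B(3) by blast
  have "vs2.independent (f ` B)"
    using linear_independent_injective_image[OF f B(2)] inj sp by simp
  moreover have "f ` D \<subseteq> vs2.span (f ` B)" using linear_span_image[OF f, of B] sp by simp
  ultimately have "card (f ` B) = vs2.dim (f ` D)"
    by (intro vs2.basis_card_eq_dim image_mono B(1))
  then show ?thesis using B card_image[OF inj_on_subset[OF inj B(1)]] by simp
qed

definition orbit :: "nat \<Rightarrow> (mon \<Rightarrow> 'a::field) \<Rightarrow> (mon \<Rightarrow> 'a) set" where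
  "orbit n \<phi> = (\<lambda>p. star p \<phi>) ` Rpolys n"

lemma subspace_orbit: "fn.subspace (orbit n \<phi>)"
  unfolding orbit_def by (rule mp_fn.linear_subspace_image[OF star_linear subspace_Rpolys])

section \<open>Derivatives and the orbit of a single summand\<close>

lemma diff_op_superset:
  assumes "finite S" "Poly_Mapping.keys g \<subseteq> S"
  shows "diff_op g p = (\<Sum>\<beta>\<in>S. smult_mp (Poly_Mapping.lookup g \<beta>) (pdiff_mon \<beta> p))"
  unfolding diff_op_def by (rule sum.mono_neutral_left) (use assms in \<open>auto simp: in_keys_iff\<close>)

lemma diff_op_add: "diff_op (g + h) p = diff_op g p + diff_op h p"
proof -
  let ?S = "Poly_Mapping.keys g \<union> Poly_Mapping.keys h"
  show ?thesis
    using diff_op_superset[of ?S g p] diff_op_superset[of ?S h p] diff_op_superset[of ?S "g + h" p]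
      Poly_Mapping.keys_add[of g h]
    by (simp add: lookup_add mp.scale_left_distrib sum.distrib)
qed

lemma diff_op_smult: "diff_op (smult_mp c g) p = smult_mp c (diff_op g p)"
  using diff_op_superset[OF finite_keys keys_smult_mp, of c g p]
  by (simp add: diff_op_def mp.scale_sum_right)

lemma diff_op_0 [simp]: "diff_op 0 p = 0"
  by (simp add: diff_op_def)

lemma diff_op_sum: "diff_op (\<Sum>x\<in>F. g x) p = (\<Sum>x\<in>F. diff_op (g x) p)"
  by (induction F rule: infinite_finite_induct) (auto simp: diff_op_add)

lemma diff_op_monomial: "diff_op (Poly_Mapping.single \<beta> 1) p = pdiff_mon \<beta> p"
  by (simp add: diff_op_def)

lemma diff_op_one [simp]: "diff_op 1 p = p"
  using diff_op_monomial[of 0 p] by simp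

lemma pdiff_mon_zero [simp]: "pdiff_mon \<beta> 0 = 0"
  by (rule poly_mapping_eqI) (simp add: lookup_pdiff_mon)

lemma pdiff_mon_sum: "pdiff_mon \<beta> (\<Sum>x\<in>F. g x) = (\<Sum>x\<in>F. pdiff_mon \<beta> (g x))"
  by (induction F rule: infinite_finite_induct) (auto simp: pdiff_mon_add)

lemma diff_op_Var_mult: "diff_op (Var j * g) p = pdiff_mon (unit_mon j) (diff_op g p)"
proof -
  have "diff_op (Var j * g) p =
    diff_op (Var j * (\<Sum>\<beta>\<in>Poly_Mapping.keys g. smult_mp (Poly_Mapping.lookup g \<beta>) (Poly_Mapping.single \<beta> 1))) p"
    using mpoly_eq_sum_monomials[of g] by simp
  also have "\<dots> = (\<Sum>\<beta>\<in>Poly_Mapping.keys g. smult_mp (Poly_Mapping.lookup g \<beta>) (pdiff_mon (\<beta> + unit_mon j) p))"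
    by (simp only: sum_distrib_left diff_op_sum smult_mp_mult_right diff_op_smult Var_mult_monomial diff_op_monomial)
  also have "\<dots> = pdiff_mon (unit_mon j) (diff_op g p)"
    unfolding diff_op_def pdiff_mon_sum pdiff_mon_smult
    by (simp only: add.commute[of _ "unit_mon j"] pdiff_mon_add_mon)
  finally show ?thesis .
qed

lemma pdiff_mon_in_Rpolys:
  assumes "p \<in> Rpolys n"
  shows "pdiff_mon \<beta> p \<in> Rpolys n"
  unfolding Rpolys_iff
proof (intro allI impI)
  fix \<alpha> assume "Poly_Mapping.lookup (pdiff_mon \<beta> p) \<alpha> \<noteq> 0"
  then have "Poly_Mapping.lookup p (\<alpha> + \<beta>) \<noteq> 0" by (auto simp: lookup_pdiff_mon)
  then have "Poly_Mapping.keys (\<alpha> + \<beta>) \<subseteq> {1..n}" using assms unfolding Rpolys_iff by blast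
  then show "Poly_Mapping.keys \<alpha> \<subseteq> {1..n}" by (simp add: keys_add_mon)
qed

lemma diff_op_in_Rpolys:
  assumes "p \<in> Rpolys n"
  shows "diff_op g p \<in> Rpolys n"
  unfolding diff_op_def
  by (intro mp.subspace_sum[OF subspace_Rpolys] mp.subspace_scale[OF subspace_Rpolys] pdiff_mon_in_Rpolys assms)

definition derivs :: "nat \<Rightarrow> 'a::field_char_0 mpoly \<Rightarrow> 'a mpoly set" where
  "derivs n w = (\<lambda>g. diff_op g w) ` Rpolys n"

lemma subspace_derivs: "mp.subspace (derivs n w)"
proof -
  have "Vector_Spaces.linear smult_mp smult_mp (\<lambda>g. diff_op g w)"
    by (simp add: Vector_Spaces.linear_iff diff_op_add diff_op_smult mp.vector_space_axioms)
  then interpret l: Vector_Spaces.linear smult_mp smult_mp "\<lambda>g. diff_op g w" .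
  show ?thesis unfolding derivs_def by (rule l.subspace_image[OF subspace_Rpolys])
qed

text \<open>g(\<partial>) w is linear in g, so the derivatives already form a subspace and equal
  their span.\<close>

lemma inv_sys_conv_derivs: "inv_sys n d l k \<omega> = derivs n (omega_dl n d l k \<omega>)"
proof -
  have "{diff_op g (omega_dl n d l k \<omega>) | g. g \<in> Rpolys n} = derivs n (omega_dl n d l k \<omega>)"
    by (auto simp: derivs_def)
  then show ?thesis unfolding inv_sys_def using subspace_derivs mp.span_eq_iff by metis
qed

text \<open>Both inclusions are inductions on the acting polynomial: x_j acts as \<xi>_j +
  \<partial>_j, conversely \<partial>_j is the action of x_j - \<xi>_j, and the orbit and the
  derivatives are subspaces.\<close>

lemma orbit_pexp:
  fixes w :: "'a::field_char_0 mpoly"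
  shows "orbit n (pexp n \<xi> w) = pexp n \<xi> ` derivs n w"
proof (intro equalityI subsetI)
  fix \<psi> assume "\<psi> \<in> orbit n (pexp n \<xi> w)"
  then obtain p where p: "p \<in> Rpolys n" "\<psi> = star p (pexp n \<xi> w)" by (auto simp: orbit_def)
  have "star p (pexp n \<xi> w) \<in> pexp n \<xi> ` derivs n w" using p(1)
  proof (induction rule: Rpolys_induct)
    case one
    have "w \<in> derivs n w" unfolding derivs_def by (rule image_eqI[of _ _ 1]) (auto simp: one_in_Rpolys)
    then show ?case by simp
  next
    case (Var j q)
    then obtain g where g: "g \<in> Rpolys n" "star q (pexp n \<xi> w) = pexp n \<xi> (diff_op g w)" by (auto simp: derivs_def)
    have "smult_mp (\<xi> j) (diff_op g w) + pdiff_mon (unit_mon j) (diff_op g w) \<in> derivs n w"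
      using g(1) Var.hyps(1) Rpolys_mult[OF Var_in_Rpolys]
      by (intro mp.subspace_add[OF subspace_derivs] mp.subspace_scale[OF subspace_derivs])
        (auto simp: derivs_def diff_op_Var_mult[symmetric])
    then show ?case using Var.hyps(1) by (auto simp: star_mult g(2) star_Var_pexp)
  next
    case (add p q)
    then show ?case
      by (simp only: star_add) (auto simp: pexp_add[symmetric] simp del: plus_fun_apply intro!: imageI mp.subspace_add[OF subspace_derivs])
  next
    case (smult c q)
    then show ?case
      by (auto simp: star_smult pexp_smult[symmetric] intro!: imageI mp.subspace_scale[OF subspace_derivs])
  qed
  then show "\<psi> \<in> pexp n \<xi> ` derivs n w" using p by simp
next
  fix \<psi> assume "\<psi> \<in> pexp n \<xi> ` derivs n w"
  then obtain g where g: "g \<in> Rpolys n" "\<psi> = pexp n \<xi> (diff_op g w)" by (auto simp: derivs_def)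
  have "pexp n \<xi> (diff_op g w) \<in> orbit n (pexp n \<xi> w)" using g(1)
  proof (induction rule: Rpolys_induct)
    case one
    then show ?case unfolding orbit_def by (intro image_eqI[of _ _ 1]) (auto simp: one_in_Rpolys)
  next
    case (Var j q)
    then obtain p where p: "p \<in> Rpolys n" "pexp n \<xi> (diff_op q w) = star p (pexp n \<xi> w)" by (auto simp: orbit_def)
    have "star (Var j) (pexp n \<xi> (diff_op q w)) =
       smult_fun (\<xi> j) (pexp n \<xi> (diff_op q w)) + pexp n \<xi> (diff_op (Var j * q) w)"
      using Var.hyps(1) by (simp only: star_Var_pexp pexp_add pexp_smult diff_op_Var_mult)
    then have "pexp n \<xi> (diff_op (Var j * q) w) = star (Var j * p) (pexp n \<xi> w) - smult_fun (\<xi> j) (star p (pexp n \<xi> w))"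
      by (simp only: star_mult p(2) add_diff_cancel_left')
    moreover have "star (Var j * p) (pexp n \<xi> w) \<in> orbit n (pexp n \<xi> w)" "star p (pexp n \<xi> w) \<in> orbit n (pexp n \<xi> w)"
      using p(1) Rpolys_mult[OF Var_in_Rpolys[OF Var.hyps(1)]] by (auto simp: orbit_def)
    ultimately show ?case
      by (simp only:) (intro fn.subspace_diff[OF subspace_orbit] fn.subspace_scale[OF subspace_orbit])
  next
    case (add p q)
    then show ?case by (simp only: diff_op_add pexp_add fn.subspace_add[OF subspace_orbit])
  next
    case (smult c q)
    then show ?case by (simp only: diff_op_smult pexp_smult fn.subspace_scale[OF subspace_orbit])
  qed
  then show "\<psi> \<in> orbit n (pexp n \<xi> w)" using g by simp
qed

lemma dim_orbit_pexp:
  fixes w :: "'a::field_char_0 mpoly"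
  assumes "w \<in> Rpolys n"
  shows "fn.dim (orbit n (pexp n \<xi> w)) = mdim (derivs n w)"
proof -
  have "derivs n w \<subseteq> Rpolys n" using diff_op_in_Rpolys[OF assms] by (auto simp: derivs_def)
  then have "inj_on (pexp n \<xi>) (derivs n w)"
    using mp_fn.linear_inj_on_iff_eq_0[OF pexp_linear subspace_derivs] pexp_eq_0_imp_eq_0 by blast
  then show ?thesis
    unfolding orbit_pexp by (rule mp_fn.dim_image_inj_on[OF pexp_linear subspace_derivs])
qed

section \<open>Separating the points\<close>

text \<open>The bound is strict so that m = 0 leaves only the zero polynomial, the place where
  iterated lowering ends.\<close>

definition Rlt :: "nat \<Rightarrow> nat \<Rightarrow> 'a::field mpoly set" where
  "Rlt n m = {p \<in> Rpolys n. \<forall>\<alpha>. Poly_Mapping.lookup p \<alpha> \<noteq> 0 \<longrightarrow> mon_deg \<alpha> < m}"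

lemma subspace_Rlt: "mp.subspace (Rlt n m)"
  using subspace_Rpolys[of n] unfolding mp.subspace_def Rlt_def
  by (auto simp: lookup_add) (metis add.right_neutral)

lemma Rpolys_imp_Rlt:
  assumes "p \<in> Rpolys n"
  shows "\<exists>m. p \<in> Rlt n m"
proof -
  \<comment> \<open>For p = 0 the maximum is taken over the empty set and is unspecified, but then
    the premise is false.\<close>
  have "Poly_Mapping.lookup p \<alpha> \<noteq> 0 \<longrightarrow> mon_deg \<alpha> < Suc (Max (mon_deg ` Poly_Mapping.keys p))" for \<alpha>
    by (auto simp: in_keys_iff less_Suc_eq_le)
  then show ?thesis using assms unfolding Rlt_def by blast
qed

lemma pdiff_unit_Rlt:
  assumes "p \<in> Rlt n (Suc m)"
  shows "pdiff_mon (unit_mon j) p \<in> Rlt n m"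
proof -
  have "mon_deg \<alpha> < m" if "Poly_Mapping.lookup (pdiff_mon (unit_mon j) p) \<alpha> \<noteq> 0" for \<alpha>
  proof -
    have "Poly_Mapping.lookup p (\<alpha> + unit_mon j) \<noteq> 0" using that by (auto simp: lookup_pdiff_mon)
    then have "mon_deg (\<alpha> + unit_mon j) < Suc m" using assms unfolding Rlt_def by blast
    then show ?thesis by (simp add: mon_deg_add)
  qed
  then show ?thesis using assms pdiff_mon_in_Rpolys by (auto simp: Rlt_def)
qed

lemma Rlt_mono: "m \<le> m' \<Longrightarrow> Rlt n m \<subseteq> Rlt n m'"
  by (auto simp: Rlt_def)

definition pexps :: "nat \<Rightarrow> (nat \<Rightarrow> 'a::field_char_0) \<Rightarrow> nat \<Rightarrow> (mon \<Rightarrow> 'a) set" where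
  "pexps n \<xi> m = pexp n \<xi> ` Rlt n m"

lemma subspace_pexps: "fn.subspace (pexps n \<xi> m)"
  unfolding pexps_def by (rule mp_fn.linear_subspace_image[OF pexp_linear subspace_Rlt])

lemma pexps_0: "pexps n \<xi> 0 = {0}"
proof -
  have "Rlt n 0 = {0 :: 'a mpoly}"
    using mp.subspace_0[OF subspace_Rlt] by (auto simp: Rlt_def intro!: poly_mapping_eqI)
  then show ?thesis by (simp add: pexps_def)
qed

lemma star_pexps:
  assumes "p \<in> Rpolys n" "\<phi> \<in> pexps n \<xi> m"
  shows "star p \<phi> \<in> pexps n \<xi> m"
  using assms(1)
proof (induction rule: Rpolys_induct)
  case one
  then show ?case using assms by simp
next
  case (Var j q)
  then obtain w where w: "w \<in> Rlt n m" "star q \<phi> = pexp n \<xi> w" by (auto simp: pexps_def)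
  then have "pdiff_mon (unit_mon j) w \<in> Rlt n m"
    by (intro pdiff_unit_Rlt subsetD[OF Rlt_mono[OF le_SucI[OF order_refl]]])
  then have "smult_mp (\<xi> j) w + pdiff_mon (unit_mon j) w \<in> Rlt n m"
    using w by (intro mp.subspace_add[OF subspace_Rlt] mp.subspace_scale[OF subspace_Rlt])
  then show ?case using Var.hyps(1) by (simp add: star_mult w(2) star_Var_pexp pexps_def)
next
  case (add p q)
  then show ?case by (simp only: star_add fn.subspace_add[OF subspace_pexps])
next
  case (smult c q)
  then show ?case by (simp only: star_smult fn.subspace_scale[OF subspace_pexps])
qed

text \<open>The condition speaks of the filtration \<open>pexps\<close> instead of values at \<xi>.
  It defines an ideal of R that contains every x_j - \<xi>_j, and the nilpotency of its elements on
  each \<open>pexps n \<xi> m\<close> is immediate.\<close>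

definition lowering :: "nat \<Rightarrow> (nat \<Rightarrow> 'a::field_char_0) \<Rightarrow> 'a mpoly set" where
  "lowering n \<xi> = {p \<in> Rpolys n. \<forall>m. \<forall>\<phi>\<in>pexps n \<xi> (Suc m). star p \<phi> \<in> pexps n \<xi> m}"

lemma subspace_lowering: "mp.subspace (lowering n \<xi>)"
  unfolding mp.subspace_def lowering_def
  by (auto simp: star_add star_smult simp del: plus_fun_apply
      intro: mp.subspace_0[OF subspace_Rpolys] mp.subspace_add[OF subspace_Rpolys] mp.subspace_scale[OF subspace_Rpolys]
       fn.subspace_0[OF subspace_pexps] fn.subspace_add[OF subspace_pexps] fn.subspace_scale[OF subspace_pexps])

lemma lowering_mult:
  assumes "p \<in> Rpolys n" "q \<in> lowering n \<xi>"
  shows "p * q \<in> lowering n \<xi>"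
  using assms by (auto simp: lowering_def star_mult intro: star_pexps Rpolys_mult)

lemma Var_minus_in_lowering:
  assumes "j \<in> {1..n}"
  shows "Var j - smult_mp (\<xi> j) 1 \<in> lowering n \<xi>"
proof -
  have R: "Var j - smult_mp (\<xi> j) 1 \<in> Rpolys n"
    by (intro mp.subspace_diff[OF subspace_Rpolys] mp.subspace_scale[OF subspace_Rpolys] Var_in_Rpolys one_in_Rpolys assms)
  have "star (Var j - smult_mp (\<xi> j) 1) \<phi> \<in> pexps n \<xi> m" if \<phi>: "\<phi> \<in> pexps n \<xi> (Suc m)" for \<phi> m
  proof -
    obtain w where w: "w \<in> Rlt n (Suc m)" "\<phi> = pexp n \<xi> w" using \<phi> by (auto simp: pexps_def)
    have "star (Var j - smult_mp (\<xi> j) 1) \<phi> = star (Var j) \<phi> - star (smult_mp (\<xi> j) 1) \<phi>"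
      by (rule mp_fn.linear_diff[OF star_linear])
    also have "\<dots> = pexp n \<xi> (pdiff_mon (unit_mon j) w)"
      by (simp only: w(2) star_Var_pexp[OF assms] star_smult star_one pexp_add pexp_smult add_diff_cancel_left')
    finally show ?thesis using pdiff_unit_Rlt[OF w(1)] by (simp add: pexps_def)
  qed
  then show ?thesis using R by (simp add: lowering_def)
qed

lemma lowering_power_nilpotent:
  assumes "p \<in> lowering n \<xi>" "\<phi> \<in> pexps n \<xi> m"
  shows "star (p ^ m) \<phi> = 0"
  using assms(2)
proof (induction m arbitrary: \<phi>)
  case 0
  then show ?case by (simp add: pexps_0)
next
  case (Suc m)
  then have "star p \<phi> \<in> pexps n \<xi> m" using assms(1) by (auto simp: lowering_def)
  from Suc.IH[OF this] show ?case by (simp only: power_Suc mult.commute[of p] star_mult)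
qed

text \<open>By the Taylor expansion at \<open>\<xi>\<close>, the lowering polynomials are those that vanish at \<open>\<xi>\<close>,
  and \<open>unit_at\<close> consists of those that do not.\<close>

definition unit_at :: "nat \<Rightarrow> (nat \<Rightarrow> 'a::field_char_0) \<Rightarrow> 'a mpoly set" where
  "unit_at n \<xi> = {p \<in> Rpolys n. \<exists>c. c \<noteq> 0 \<and> p - smult_mp c 1 \<in> lowering n \<xi>}"

lemma one_unit_at: "1 \<in> unit_at n \<xi>"
  using mp.subspace_0[OF subspace_lowering] by (auto simp: unit_at_def one_in_Rpolys intro!: exI[of _ 1])

lemma unit_at_mult:
  assumes "p \<in> unit_at n \<xi>" "q \<in> unit_at n \<xi>"
  shows "p * q \<in> unit_at n \<xi>"
proof -
  obtain c e where c: "c \<noteq> 0" "p - smult_mp c 1 \<in> lowering n \<xi>" "e \<noteq> 0" "q - smult_mp e 1 \<in> lowering n \<xi>"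
    using assms by (auto simp: unit_at_def)
  have "p * q - smult_mp (c * e) 1 = p * (q - smult_mp e 1) + smult_mp e (p - smult_mp c 1)"
    by (simp add: right_diff_distrib smult_mp_mult_right mp.scale_right_diff_distrib mult.commute)
  moreover have "p * (q - smult_mp e 1) + smult_mp e (p - smult_mp c 1) \<in> lowering n \<xi>"
    using c assms by (intro mp.subspace_add[OF subspace_lowering] lowering_mult mp.subspace_scale[OF subspace_lowering])
     (auto simp: unit_at_def)
  ultimately show ?thesis using c assms by (auto simp: unit_at_def intro!: Rpolys_mult exI[of _ "c * e"])
qed

lemma unit_at_power: "p \<in> unit_at n \<xi> \<Longrightarrow> p ^ m \<in> unit_at n \<xi>"
  by (induction m) (auto intro: one_unit_at unit_at_mult)

lemma unit_at_separating:
  assumes "j \<in> {1..n}" "\<xi> j \<noteq> \<zeta> j"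
  shows "Var j - smult_mp (\<zeta> j) 1 \<in> unit_at n \<xi>"
proof -
  have "Var j - smult_mp (\<zeta> j) 1 \<in> Rpolys n"
    by (intro mp.subspace_diff[OF subspace_Rpolys] mp.subspace_scale[OF subspace_Rpolys] Var_in_Rpolys one_in_Rpolys assms)
  moreover have "Var j - smult_mp (\<zeta> j) 1 - smult_mp (\<xi> j - \<zeta> j) 1 = Var j - smult_mp (\<xi> j) 1"
    by (simp add: mp.scale_left_diff_distrib)
  then have "Var j - smult_mp (\<zeta> j) 1 - smult_mp (\<xi> j - \<zeta> j) 1 \<in> lowering n \<xi>"
    using Var_minus_in_lowering[OF assms(1), of \<xi>] by (simp only:)
  moreover have "\<xi> j - \<zeta> j \<noteq> 0" using assms(2) by simp
  ultimately show ?thesis unfolding unit_at_def by blast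
qed

text \<open>For each j some coordinate m separates \<zeta> from the j-th point. A power of x_m -
  \<xi>_{j,m} above the degree of \<open>W j\<close> kills the j-th summand and does not vanish at
  \<zeta>; the product of these powers serves all j at once.\<close>

lemma annihilator_unit_at:
  fixes \<xi> :: "nat \<Rightarrow> nat \<Rightarrow> 'a::field_char_0"
  assumes "finite J"
    and "\<And>j. j \<in> J \<Longrightarrow> W j \<in> Rpolys n"
    and "\<And>j. j \<in> J \<Longrightarrow> \<exists>m\<in>{1..n}. \<zeta> m \<noteq> \<xi> j m"
  shows "\<exists>h\<in>unit_at n \<zeta>. \<forall>j\<in>J. star h (pexp n (\<xi> j) (W j)) = 0"
  using assms
proof (induction J)
  case empty
  then show ?case using one_unit_at by blast
next
  case (insert i J)
  have "\<exists>h\<in>unit_at n \<zeta>. \<forall>j\<in>J. star h (pexp n (\<xi> j) (W j)) = 0"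
    by (rule insert.IH) (use insert.prems in blast)+
  then obtain h where h: "h \<in> unit_at n \<zeta>" "\<And>j. j \<in> J \<Longrightarrow> star h (pexp n (\<xi> j) (W j)) = 0" by blast
  obtain m where m: "m \<in> {1..n}" "\<zeta> m \<noteq> \<xi> i m" using insert.prems by blast
  obtain M where M: "W i \<in> Rlt n M" using Rpolys_imp_Rlt insert.prems by blast
  define g where "g = (Var m - smult_mp (\<xi> i m) 1) ^ M"
  have "g \<in> unit_at n \<zeta>" unfolding g_def by (intro unit_at_power unit_at_separating m)
  moreover have "star g (pexp n (\<xi> i) (W i)) = 0" unfolding g_def
    by (rule lowering_power_nilpotent[OF Var_minus_in_lowering[OF m(1)]]) (simp add: pexps_def M)
  ultimately have "h * g \<in> unit_at n \<zeta>" "star (h * g) (pexp n (\<xi> i) (W i)) = 0"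
    using h(1) by (auto intro: unit_at_mult simp: star_mult)
  moreover have "star (h * g) (pexp n (\<xi> j) (W j)) = 0" if "j \<in> J" for j
    using h(2)[OF that] by (simp add: mult.commute[of h] star_mult)
  ultimately show ?case by blast
qed

text \<open>\<open>h\<close> acts on the i-th summand as a constant c plus a nilpotent operator, so
  for y = h / c a power of 1 - y kills that summand and u = 1 - (1 - y)^M fixes it. By the geometric
  sum u is a multiple of y, hence kills the other summands.\<close>

lemma separating_idempotent:
  fixes \<xi> :: "nat \<Rightarrow> nat \<Rightarrow> 'a::field_char_0"
  assumes W: "\<And>j. j \<in> I \<Longrightarrow> W j \<in> Rpolys n" and I: "finite I" "i \<in> I"
    and sep: "\<And>j. j \<in> I \<Longrightarrow> j \<noteq> i \<Longrightarrow> \<exists>m\<in>{1..n}. \<xi> i m \<noteq> \<xi> j m"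
  shows "\<exists>u\<in>Rpolys n. \<forall>j\<in>I. star u (pexp n (\<xi> j) (W j)) = (if j = i then pexp n (\<xi> j) (W j) else 0)"
proof -
  obtain h where h: "h \<in> unit_at n (\<xi> i)" "\<And>j. j \<in> I - {i} \<Longrightarrow> star h (pexp n (\<xi> j) (W j)) = 0"
    using annihilator_unit_at[of "I - {i}" W n "\<xi> i" \<xi>] assms by auto
  obtain c where c: "c \<noteq> 0" "h - smult_mp c 1 \<in> lowering n (\<xi> i)" and hR: "h \<in> Rpolys n"
    using h(1) by (auto simp: unit_at_def)
  obtain M where M: "W i \<in> Rlt n M" using Rpolys_imp_Rlt W I by blast
  define y where "y = smult_mp (1 / c) h"
  have yR: "y \<in> Rpolys n" unfolding y_def by (rule mp.subspace_scale[OF subspace_Rpolys hR])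
  have "1 - y = smult_mp (- 1 / c) (h - smult_mp c 1)"
    using c(1) by (simp add: y_def mp.scale_right_diff_distrib)
  then have "1 - y \<in> lowering n (\<xi> i)" using mp.subspace_scale[OF subspace_lowering c(2)] by (simp only:)
  then have nil: "star ((1 - y) ^ M) (pexp n (\<xi> i) (W i)) = 0"
    by (rule lowering_power_nilpotent) (simp add: pexps_def M)
  define u where "u = 1 - (1 - y) ^ M"
  have uR: "u \<in> Rpolys n" unfolding u_def
    by (intro mp.subspace_diff[OF subspace_Rpolys] Rpolys_power yR one_in_Rpolys)
  have "star u (pexp n (\<xi> i) (W i)) = pexp n (\<xi> i) (W i)"
    unfolding u_def using nil by (simp only: mp_fn.linear_diff[OF star_linear] star_one diff_zero)
  moreover have "star u (pexp n (\<xi> j) (W j)) = 0" if "j \<in> I - {i}" for j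
  proof -
    have "u = (\<Sum>k<M. (1 - y) ^ k) * y" unfolding u_def by (simp add: one_diff_power_eq mult.commute)
    moreover have "star y (pexp n (\<xi> j) (W j)) = 0" unfolding y_def by (simp only: star_smult h(2)[OF that] fn.scale_zero_right)
    ultimately show ?thesis by (simp only: star_mult star_fun_0)
  qed
  ultimately show ?thesis using uR by (intro bexI[of _ u]) auto
qed

lemma pexp_supported:
  assumes "w \<in> Rpolys n" "\<not> Poly_Mapping.keys \<alpha> \<subseteq> {1..n}"
  shows "pexp n \<xi> w \<alpha> = 0"
proof -
  have "series_mult (Poly_Mapping.lookup w) (exp_series n \<xi>) \<alpha> = 0" unfolding series_mult_def
  proof (rule sum.neutral, clarify)
    fix \<beta> \<gamma> assume "\<alpha> = \<beta> + \<gamma>"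
    then have "\<not> Poly_Mapping.keys \<beta> \<subseteq> {1..n} \<or> \<not> Poly_Mapping.keys \<gamma> \<subseteq> {1..n}"
      using assms(2) by (auto simp: keys_add_mon)
    then show "Poly_Mapping.lookup w \<beta> * exp_series n \<xi> \<gamma> = 0"
      using assms(1) unfolding Rpolys_iff exp_series_def by auto
  qed
  then show ?thesis by (simp add: pexp_apply)
qed

lemma linear_star_fun: "Vector_Spaces.linear smult_fun smult_fun (star p)"
  by (simp only: Vector_Spaces.linear_iff star_fun_add star_fun_smult fn.vector_space_axioms simp_thms)

text \<open>Applying \<open>u i\<close> to \<phi> isolates the i-th summand, so the orbit of each
  summand lies in the orbit of \<phi>. The operators \<open>star (u i)\<close> are the maps that
  \<open>dim_direct_sum\<close> asks for.\<close>

lemma dim_orbit_sum_pexp: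
  fixes \<xi> :: "nat \<Rightarrow> nat \<Rightarrow> 'a::field_char_0"
  assumes W: "\<And>j. j \<in> I \<Longrightarrow> W j \<in> Rpolys n" and I: "finite I"
    and sep: "\<And>i j. i \<in> I \<Longrightarrow> j \<in> I \<Longrightarrow> j \<noteq> i \<Longrightarrow> \<exists>m\<in>{1..n}. \<xi> i m \<noteq> \<xi> j m"
    and \<phi>: "\<phi> = (\<Sum>i\<in>I. pexp n (\<xi> i) (W i))"
    and F: "finite F" "orbit n \<phi> \<subseteq> fn.span F"
  shows "fn.dim (orbit n \<phi>) = (\<Sum>i\<in>I. mdim (derivs n (W i)))"
proof -
  let ?L = "\<lambda>i. pexp n (\<xi> i) (W i)"
  have "\<forall>i\<in>I. \<exists>u\<in>Rpolys n. \<forall>j\<in>I. star u (?L j) = (if j = i then ?L j else 0)"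
    by (intro ballI separating_idempotent[OF W I] sep)
  then obtain u where "\<forall>i\<in>I. u i \<in> Rpolys n \<and> (\<forall>j\<in>I. star (u i) (?L j) = (if j = i then ?L j else 0))"
    unfolding Bex_def by (rule bchoice[THEN exE])
  then have u: "\<And>i. i \<in> I \<Longrightarrow> u i \<in> Rpolys n"
    "\<And>i j. i \<in> I \<Longrightarrow> j \<in> I \<Longrightarrow> star (u i) (?L j) = (if j = i then ?L j else 0)"
    by blast+
  have u\<phi>: "star (u i) \<phi> = ?L i" if "i \<in> I" for i
  proof -
    have "star (u i) \<phi> = (\<Sum>j\<in>I. star (u i) (?L j))" unfolding \<phi> by (rule star_fun_sum)
    also have "\<dots> = (\<Sum>j\<in>I. if j = i then ?L j else 0)" by (rule sum.cong[OF refl]) (simp only: u(2)[OF that])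
    also have "\<dots> = ?L i" using that I by (subst sum.delta) simp_all
    finally show ?thesis .
  qed
  have "fn.dim (orbit n \<phi>) = (\<Sum>i\<in>I. fn.dim (orbit n (?L i)))"
  proof (rule fn.dim_direct_sum[where \<pi> = "\<lambda>i. star (u i)", OF I _ _ F linear_star_fun])
    show "orbit n (?L i) \<subseteq> orbit n \<phi>" if "i \<in> I" for i
    proof
      fix \<psi> assume "\<psi> \<in> orbit n (?L i)"
      then obtain p where "p \<in> Rpolys n" "\<psi> = star p (?L i)" by (auto simp: orbit_def)
      then have "\<psi> = star (p * u i) \<phi>" "p * u i \<in> Rpolys n"
        using u\<phi>[OF that] u(1)[OF that] Rpolys_mult by (simp_all only: star_mult) 
      then show "\<psi> \<in> orbit n \<phi>" unfolding orbit_def by (rule image_eqI)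
    qed
    show "v \<in> fn.span (\<Union>i\<in>I. orbit n (?L i))" if v: "v \<in> orbit n \<phi>" for v
    proof -
      obtain p where p: "p \<in> Rpolys n" "v = star p \<phi>" using v by (auto simp: orbit_def)
      have eq: "v = (\<Sum>i\<in>I. star p (?L i))" unfolding p(2) \<phi> by (rule star_fun_sum)
      have "star p (?L i) \<in> fn.span (\<Union>i\<in>I. orbit n (?L i))" if "i \<in> I" for i
        using p(1) that by (intro fn.span_base) (auto simp: orbit_def)
      then show ?thesis unfolding eq by (rule fn.span_sum)
    qed
    show "star (u i) x = x" if i: "i \<in> I" and x: "x \<in> orbit n (?L i)" for i x
    proof -
      obtain p where "x = star p (?L i)" using x by (auto simp: orbit_def)
      \<comment> \<open>Commutativity of R moves \<open>u i\<close> past \<open>p\<close> onto the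
        generator of the orbit.\<close>
      then have "star (u i) x = star p (star (u i) (?L i))" by (simp only: star_mult[symmetric] mult.commute)
      then show ?thesis using \<open>x = _\<close> u(2)[OF i i] by simp
    qed
    show "star (u i) x = 0" if i: "i \<in> I" "j \<in> I" "i \<noteq> j" and x: "x \<in> orbit n (?L j)" for i j x
    proof -
      obtain p where "x = star p (?L j)" using x by (auto simp: orbit_def)
      then have "star (u i) x = star p (star (u i) (?L j))" by (simp only: star_mult[symmetric] mult.commute)
      then show ?thesis using u(2)[OF i(1,2)] i(3) by simp
    qed
  qed
  also have "\<dots> = (\<Sum>i\<in>I. mdim (derivs n (W i)))"
    by (rule sum.cong[OF refl]) (rule dim_orbit_pexp[OF W])
  finally show ?thesis .
qed

section \<open>Bases of the quotient algebra\<close>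

text \<open>The right factors express the columns of each matrix through those of the other, so the
  column spaces coincide.\<close>

lemma (in vec_space) rank_eq_if_factors:
  assumes H: "H \<in> carrier_mat n a" and C: "C \<in> carrier_mat n b"
    and Y: "Y \<in> carrier_mat b a" "H = C * Y" and X: "X \<in> carrier_mat a b" "C = H * X"
  shows "rank H = rank C"
proof -
  have sub: "col_space (M * N) \<subseteq> col_space M" if M: "M \<in> carrier_mat n m" and N: "N \<in> carrier_mat m l" for M N m l
  proof
    fix y assume "y \<in> col_space (M * N)"
    then obtain x where x: "x \<in> carrier_vec l" "y = (M * N) *\<^sub>v x"
      using col_space_eq[of "M * N" l] M N by auto
    then have "y = M *\<^sub>v (N *\<^sub>v x)" using assoc_mult_mat_vec[OF M N] by simp
    moreover have "N *\<^sub>v x \<in> carrier_vec m" using N x by auto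
    ultimately show "y \<in> col_space M" using col_space_eq[OF M] M by auto
  qed
  have "col_space H = col_space C" using sub[OF C Y(1), folded Y(2)] sub[OF H X(1), folded X(2)] by blast
  then show ?thesis by (simp add: rank_def col_space_def)
qed

lemma (in vec_space) rank_eq_if_trivial_kernel:
  assumes C: "C \<in> carrier_mat n b"
    and ker: "\<And>x. x \<in> carrier_vec b \<Longrightarrow> C *\<^sub>v x = 0\<^sub>v n \<Longrightarrow> x = 0\<^sub>v b"
  shows "rank C = b"
proof (rule lin_indpt_full_rank[OF C])
  \<comment> \<open>Independence is a property of the set of columns, so repetitions are excluded
    first: two equal columns would put a difference of unit vectors into the kernel.\<close>
  show dist: "distinct (cols C)"
  proof (rule ccontr)
    assume "\<not> distinct (cols C)"
    then obtain i j where ij: "i < b" "j < b" "i \<noteq> j" "col C i = col C j"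
      using C by (auto simp: distinct_conv_nth)
    let ?x = "unit_vec b i - unit_vec b j :: 'a vec"
    have col: "C *\<^sub>v unit_vec b l = col C l" if "l < b" for l
      by (rule eq_vecI) (use C that in \<open>auto simp: scalar_prod_right_unit\<close>)
    have "C *\<^sub>v ?x = C *\<^sub>v unit_vec b i - C *\<^sub>v unit_vec b j"
      by (rule mult_minus_distrib_mat_vec[OF C]) auto
    also have "\<dots> = col C i - col C j" using col ij by simp
    also have "\<dots> = 0\<^sub>v n" using ij C by auto
    finally have "?x = 0\<^sub>v b" by (rule ker[rotated]) simp
    then have "?x $ i = 0" using ij by simp
    then show False using ij by simp
  qed
  show "lin_indpt (set (cols C))"
    using lin_depE[OF C _ dist] ker by metis
qed

text \<open>Phrased with \<open>mat_inverse\<close> because the multiplication matrices of the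
  theorem are formed with it.\<close>

lemma mat_inverse_if_trivial_kernel:
  fixes M :: "'a::field mat"
  assumes M: "M \<in> carrier_mat N N"
    and ker: "\<And>x. x \<in> carrier_vec N \<Longrightarrow> M *\<^sub>v x = 0\<^sub>v N \<Longrightarrow> x = 0\<^sub>v N"
  obtains M' where "mat_inverse M = Some M'" "M' \<in> carrier_mat N N" "M * M' = 1\<^sub>m N" "M' * M = 1\<^sub>m N"
proof -
  have "det M \<noteq> 0" using det_0_iff_vec_prod_zero_field[OF M] ker by blast
  then have "M \<in> Units (ring_mat TYPE('a) N ())" by (rule det_non_zero_imp_unit[OF M])
  then obtain M' where "mat_inverse M = Some M'"
    using mat_inverse(1)[OF M, of "()"] by (cases "mat_inverse M") auto
  then show thesis using that mat_inverse(2)[OF M] by blast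
qed

text \<open>Coefficients are indexed by list positions, as matrix columns are, whereas
  \<open>classes_basis\<close> indexes them by elements.\<close>

definition list_comb :: "'a::field mpoly list \<Rightarrow> (nat \<Rightarrow> 'a) \<Rightarrow> 'a mpoly" where
  "list_comb xs a = (\<Sum>j<length xs. smult_mp (a j) (xs ! j))"

lemma sum_set_conv_nth:
  assumes "distinct xs"
  shows "(\<Sum>x\<in>set xs. g x) = (\<Sum>j<length xs. g (xs ! j))"
  using sum.reindex_bij_betw[OF bij_betw_nth[OF assms refl refl], of g] by simp

lemma list_comb_in_span: "list_comb xs a \<in> mspan (set xs)"
  unfolding list_comb_def by (intro mp.span_sum mp.span_scale mp.span_base) simp

lemma span_list_comb:
  assumes "distinct xs" "p \<in> mspan (set xs)"
  obtains a where "p = list_comb xs a"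
proof -
  obtain a where "p = (\<Sum>x\<in>set xs. smult_mp (a x) x)"
    using assms(2) by (auto simp: mp.span_finite)
  then show thesis using that[of "\<lambda>j. a (xs ! j)"] by (simp only: list_comb_def sum_set_conv_nth[OF assms(1)])
qed

lemma dual_app_list_comb: "dual_app \<phi> (q * list_comb xs a) = (\<Sum>j<length xs. dual_app \<phi> (q * xs ! j) * a j)"
  unfolding list_comb_def sum_distrib_left dual_app_sum smult_mp_mult_right dual_app_smult
  by (simp add: mult.commute)

text \<open>Monomials span R, so testing on them is testing on R. In this form I_\<phi> is the
  radical of the symmetric pairing \<phi>(p q).\<close>

lemma Iphi_iff:
  fixes \<phi> :: "mon \<Rightarrow> 'a::field"
  shows "p \<in> Iphi n \<phi> \<longleftrightarrow> p \<in> Rpolys n \<and> (\<forall>q\<in>Rpolys n. dual_app \<phi> (p * q) = 0)"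
proof (intro iffI conjI ballI)
  fix q :: "'a mpoly" assume p: "p \<in> Iphi n \<phi>" and q: "q \<in> Rpolys n"
  have "dual_app (star p \<phi>) q = 0" unfolding dual_app_def
    using p q by (intro sum.neutral) (auto simp: Iphi_def Rpolys_def)
  then show "dual_app \<phi> (p * q) = 0" by (simp only: dual_app_star)
next
  assume "p \<in> Rpolys n \<and> (\<forall>q\<in>Rpolys n. dual_app \<phi> (p * q) = 0)"
  then show "p \<in> Iphi n \<phi>" using monomial_in_Rpolys[of _ n 1] by (auto simp: Iphi_def star_def)
qed (simp add: Iphi_def)

lemma Iphi_subset_Rpolys: "Iphi n \<phi> \<subseteq> Rpolys n"
  by (auto simp: Iphi_def)

lemma subspace_Iphi: "mp.subspace (Iphi n \<phi>)"
  using subspace_Rpolys[of n] unfolding mp.subspace_def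
  by (auto simp: Iphi_iff distrib_right dual_app_add smult_mp_mult_left dual_app_smult)

lemma Iphi_mult:
  assumes "p \<in> Iphi n \<phi>" "q \<in> Rpolys n"
  shows "q * p \<in> Iphi n \<phi>"
  using assms unfolding Iphi_iff
  by (auto intro: Rpolys_mult simp: mult.assoc mult.commute[of q])

text \<open>\<open>Iphi\<close> tests only monomials in x_1, ..., x_n. If \<phi> is supported there,
  \<open>star p \<phi>\<close> vanishes at every other monomial by itself, so I_\<phi> is the kernel
  of p \<mapsto> p \<star> \<phi> on R.\<close>

lemma Iphi_conv_star:
  assumes supp: "\<And>\<alpha>. \<not> Poly_Mapping.keys \<alpha> \<subseteq> {1..n} \<Longrightarrow> \<phi> \<alpha> = 0"
  shows "Iphi n \<phi> = {p \<in> Rpolys n. star p \<phi> = 0}"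
proof -
  have "star p \<phi> \<alpha> = 0" if \<alpha>: "\<not> Poly_Mapping.keys \<alpha> \<subseteq> {1..n}" for p \<alpha>
    unfolding star_def dual_app_def
  proof (intro sum.neutral ballI)
    fix \<beta> assume "\<beta> \<in> Poly_Mapping.keys (p * Poly_Mapping.single \<alpha> 1)"
    then obtain \<gamma> where "\<beta> = \<gamma> + \<alpha>" using keys_mult[of p "Poly_Mapping.single \<alpha> 1"] by auto
    then have "\<phi> \<beta> = 0" using \<alpha> by (intro supp) (auto simp: keys_add_mon)
    then show "Poly_Mapping.lookup (p * Poly_Mapping.single \<alpha> 1) \<beta> * \<phi> \<beta> = 0" by simp
  qed
  then show ?thesis unfolding Iphi_def fun_eq_iff zero_fun_apply by blast
qed

lemma classes_basisD:
  assumes "classes_basis n I (set B)" "(\<Sum>b\<in>set B. smult_mp (c b) b) \<in> I" "b \<in> set B"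
  shows "c b = 0"
proof -
  have "\<forall>F c. finite F \<and> F \<subseteq> set B \<and> (\<Sum>b\<in>F. smult_mp (c b) b) \<in> I \<longrightarrow> (\<forall>b\<in>F. c b = 0)"
    using assms(1) unfolding classes_basis_def by (rule conjunct1[OF conjunct2])
  from this[rule_format, of "set B" c] show ?thesis using assms(2,3) by simp
qed

lemma classes_basis_list_comb:
  assumes "distinct B" "classes_basis n I (set B)" "list_comb B a \<in> I" "j < length B"
  shows "a j = 0"
proof -
  \<comment> \<open>Carries the coefficients from positions to elements, using that
    \<open>nth B\<close> is injective.\<close>
  let ?c = "\<lambda>b. a (the_inv_into {..<length B} (nth B) b)"
  have inj: "inj_on (nth B) {..<length B}" using assms(1) by (simp add: inj_on_nth)
  have c: "?c (B ! i) = a i" if "i < length B" for i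
    using the_inv_into_f_f[OF inj] that by simp
  have "(\<Sum>b\<in>set B. smult_mp (?c b) b) = list_comb B a"
    unfolding sum_set_conv_nth[OF assms(1)] list_comb_def by (rule sum.cong) (simp_all add: c)
  then have "(\<Sum>b\<in>set B. smult_mp (?c b) b) \<in> I" using assms(3) by (simp only:)
  from classes_basisD[where c = ?c, OF assms(2) this nth_mem[OF assms(4)]] have "?c (B ! j) = 0" .
  then show ?thesis using c[OF assms(4)] by simp
qed

lemma classes_basis_reduce:
  assumes "classes_basis n I (set B)" "distinct B" "p \<in> Rpolys n"
  obtains a where "p - list_comb B a \<in> I"
proof -
  obtain q where "q \<in> mspan (set B)" "p - q \<in> I" using assms(1,3) unfolding classes_basis_def by blast
  then show thesis using span_list_comb[OF assms(2)] that by blast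
qed

text \<open>On the span of \<open>B\<close>, p \<mapsto> p \<star> \<phi> is injective by
  independence modulo I_\<phi> and reaches the whole orbit by generation modulo I_\<phi>. The second
  claim provides the finite spanning set for \<open>dim_orbit_sum_pexp\<close>.\<close>

lemma length_classes_basis:
  assumes supp: "\<And>\<alpha>. \<not> Poly_Mapping.keys \<alpha> \<subseteq> {1..n} \<Longrightarrow> \<phi> \<alpha> = 0"
    and B: "distinct B" "classes_basis n (Iphi n \<phi>) (set B)"
  shows "length B = fn.dim (orbit n \<phi>)" and "orbit n \<phi> \<subseteq> fn.span ((\<lambda>p. star p \<phi>) ` set B)"
proof -
  let ?\<rho> = "\<lambda>p. star p \<phi>"
  note I = Iphi_conv_star[where n = n and \<phi> = \<phi>, OF supp]
  have BR: "mspan (set B) \<subseteq> Rpolys n"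
    using B(2) by (intro mp.span_minimal subspace_Rpolys) (simp add: classes_basis_def)
  have zero: "p = 0" if p: "p \<in> mspan (set B)" "star p \<phi> = 0" for p
  proof -
    obtain a where a: "p = list_comb B a" using span_list_comb[OF B(1) p(1)] .
    have "p \<in> Iphi n \<phi>" using p BR I by blast
    then have "a j = 0" if "j < length B" for j using classes_basis_list_comb[OF B] a that by blast
    then show ?thesis unfolding a list_comb_def by (intro sum.neutral) auto
  qed
  have inj: "inj_on ?\<rho> (mspan (set B))"
    using mp_fn.linear_inj_on_iff_eq_0[OF star_linear mp.subspace_span] zero by blast
  have "mindep (set B)"
  proof (rule mp.independent_if_scalars_zero[OF finite_set])
    fix c b assume z: "(\<Sum>x\<in>set B. smult_mp (c x) x) = 0" and b: "b \<in> set B"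
    have "(\<Sum>x\<in>set B. smult_mp (c x) x) \<in> Iphi n \<phi>"
      unfolding z by (rule mp.subspace_0[OF subspace_Iphi])
    from classes_basisD[where c = c, OF B(2) this b] show "c b = 0" .
  qed
  then have "mdim (mspan (set B)) = length B"
    using mp.dim_span_eq_card_independent distinct_card[OF B(1)] by metis
  then have dim: "fn.dim (?\<rho> ` mspan (set B)) = length B"
    using mp_fn.dim_image_inj_on[OF star_linear mp.subspace_span inj] by simp
  have "?\<rho> ` mspan (set B) = orbit n \<phi>"
  proof (intro equalityI subsetI)
    fix \<psi> assume "\<psi> \<in> orbit n \<phi>"
    then obtain p where p: "p \<in> Rpolys n" "\<psi> = star p \<phi>" by (auto simp: orbit_def)
    obtain q where q: "q \<in> mspan (set B)" "p - q \<in> Iphi n \<phi>"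
      using B(2) p(1) unfolding classes_basis_def by blast
    have "star (p - q) \<phi> = 0" using q(2) I by blast
    then have "star p \<phi> = star q \<phi>" by (simp only: mp_fn.linear_diff[OF star_linear] right_minus_eq)
    then show "\<psi> \<in> ?\<rho> ` mspan (set B)" using p q by blast
  qed (use BR in \<open>auto simp: orbit_def\<close>)
  then show "length B = fn.dim (orbit n \<phi>)" "orbit n \<phi> \<subseteq> fn.span (?\<rho> ` set B)"
    using dim mp_fn.linear_span_image[OF star_linear, of \<phi> "set B"] by simp_all
qed

section \<open>Ideals generated by a set of polynomials\<close>

lemma ideal_R_subset:
  assumes "G \<subseteq> Iphi n \<phi>"
  shows "ideal_R n G \<subseteq> Iphi n \<phi>"
  using assms unfolding ideal_R_def
  by (auto intro!: mp.subspace_sum[OF subspace_Iphi] Iphi_mult)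

lemma ideal_R_base:
  assumes "g \<in> G"
  shows "g \<in> ideal_R n G"
  unfolding ideal_R_def using assms one_in_Rpolys
  by (auto intro!: exI[of _ "{g}"] exI[of _ "\<lambda>_. 1"])

lemma ideal_R_add:
  assumes "p \<in> ideal_R n G" "q \<in> ideal_R n G"
  shows "p + q \<in> ideal_R n G"
proof -
  obtain F r F' r' where p: "p = (\<Sum>g\<in>F. r g * g)" "finite F" "F \<subseteq> G" "\<forall>g\<in>F. r g \<in> Rpolys n"
    and q: "q = (\<Sum>g\<in>F'. r' g * g)" "finite F'" "F' \<subseteq> G" "\<forall>g\<in>F'. r' g \<in> Rpolys n"
    using assms unfolding ideal_R_def by blast
  \<comment> \<open>The two combinations may use different generators; their coefficients are
    extended by zero to the union.\<close>
  let ?t = "\<lambda>g. (if g \<in> F then r g else 0) + (if g \<in> F' then r' g else 0)"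
  have "(\<Sum>g\<in>F \<union> F'. (if g \<in> F then r g else 0) * g) = p"
    unfolding p(1) by (rule sum.mono_neutral_cong_right) (use p q in auto)
  moreover have "(\<Sum>g\<in>F \<union> F'. (if g \<in> F' then r' g else 0) * g) = q"
    unfolding q(1) by (rule sum.mono_neutral_cong_right) (use p q in auto)
  ultimately have "p + q = (\<Sum>g\<in>F \<union> F'. ?t g * g)" by (simp only: distrib_right sum.distrib)
  moreover have "?t g \<in> Rpolys n" if "g \<in> F \<union> F'" for g
    using p q that mp.subspace_0[OF subspace_Rpolys] by (intro mp.subspace_add[OF subspace_Rpolys]) auto
  ultimately show ?thesis using p q unfolding ideal_R_def
    by (intro CollectI exI[of _ "F \<union> F'"] exI[of _ ?t]) auto
qed

lemma ideal_R_mult: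
  assumes "p \<in> ideal_R n G" "q \<in> Rpolys n"
  shows "q * p \<in> ideal_R n G"
proof -
  obtain F r where p: "p = (\<Sum>g\<in>F. r g * g)" "finite F" "F \<subseteq> G" "\<forall>g\<in>F. r g \<in> Rpolys n"
    using assms unfolding ideal_R_def by blast
  have "q * p = (\<Sum>g\<in>F. (q * r g) * g)" unfolding p(1) by (simp add: sum_distrib_left mult.assoc)
  then show ?thesis using p assms(2) unfolding ideal_R_def
    by (intro CollectI exI[of _ F] exI[of _ "\<lambda>g. q * r g"]) (auto intro: Rpolys_mult)
qed

lemma smult_mp_conv_mult: "smult_mp c p = smult_mp c 1 * p"
  by (simp add: smult_mp_mult_left)

lemma subspace_ideal_R: "mp.subspace (ideal_R n G)"
  unfolding mp.subspace_def
proof (intro conjI allI ballI)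
  show "0 \<in> ideal_R n G" unfolding ideal_R_def by (auto intro!: exI[of _ "{}"])
  show "smult_mp c p \<in> ideal_R n G" if "p \<in> ideal_R n G" for c p
    unfolding smult_mp_conv_mult[of c p]
    using that one_in_Rpolys by (intro ideal_R_mult mp.subspace_scale[OF subspace_Rpolys])
qed (rule ideal_R_add)

section \<open>Hankel matrices\<close>

text \<open>Isolates the linear algebra. The decomposition of \<open>f\<close> enters only through
  \<open>agree\<close> and \<open>len\<close>.\<close>

locale hankel_extension =
  fixes n d c :: nat and f :: "'a::field mpoly" and \<phi> :: "mon \<Rightarrow> 'a" and B B' A A' :: "'a mpoly list"
  assumes agree: "p \<in> Rle n d \<Longrightarrow> dual_app (fcheck d f) p = dual_app \<phi> p"
    and B: "distinct B" "classes_basis n (Iphi n \<phi>) (set B)"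
    and B': "distinct B'" "classes_basis n (Iphi n \<phi>) (set B')"
    and len: "length B' = length B"
    and one_B: "1 \<in> set B"
    and c: "c \<le> d"
    and A: "distinct A" "set A \<subseteq> Rle n c"
    and A': "distinct A'" "set A' \<subseteq> Rle n (d - c)"
    and BA: "Bplus n (set B) \<subseteq> mspan (set A)" and BA': "set B' \<subseteq> mspan (set A')"
begin

abbreviation "I \<equiv> Iphi n \<phi>"
abbreviation "H\<^sub>0 \<equiv> hankel d f B' B"

lemma span_A: "mspan (set A) \<subseteq> Rle n c"
  by (rule mp.span_minimal[OF A(2) subspace_Rle])

lemma span_A': "mspan (set A') \<subseteq> Rle n (d - c)"
  by (rule mp.span_minimal[OF A'(2) subspace_Rle])

lemma B_span_A: "set B \<subseteq> mspan (set A)"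
  using BA by (auto simp: Bplus_def)

lemma Var_B_span_A: "i \<in> {1..n} \<Longrightarrow> b \<in> set B \<Longrightarrow> Var i * b \<in> mspan (set A)"
  using BA unfolding Bplus_def by blast

text \<open>The degree bounds c and d - c add up to d, just within the reach of
  \<open>agree\<close>.\<close>

lemma fcheck_span:
  assumes "p \<in> mspan (set A)" "q \<in> mspan (set A')"
  shows "dual_app (fcheck d f) (q * p) = dual_app \<phi> (q * p)"
proof (rule agree)
  have "q * p \<in> Rle n (d - c + c)" by (rule Rle_mult) (use assms span_A span_A' in auto)
  then show "q * p \<in> Rle n d" using c by simp
qed

lemma set_B_Rpolys: "set B \<subseteq> Rpolys n" "set B' \<subseteq> Rpolys n"
  using B B' by (auto simp: classes_basis_def)

lemma dual_app_zero_span: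
  assumes "\<And>x. x \<in> set xs \<Longrightarrow> dual_app \<phi> (x * p) = 0" "q \<in> mspan (set xs)"
  shows "dual_app \<phi> (q * p) = 0"
  using assms(2)
proof (induction rule: mp.span_induct_alt)
  case base
  then show ?case by simp
next
  case (step a x y)
  then show ?case using assms(1) by (simp add: distrib_right dual_app_add smult_mp_mult_left dual_app_smult)
qed

text \<open>R is the span of \<open>B'\<close> plus I_\<phi>, and by symmetry of the pairing the
  part of a test polynomial in I_\<phi> contributes nothing.\<close>

lemma in_I_if_orthogonal_B':
  assumes p: "p \<in> Rpolys n" and z: "\<And>b. b \<in> set B' \<Longrightarrow> dual_app \<phi> (b * p) = 0"
  shows "p \<in> I"
  unfolding Iphi_iff
proof (intro conjI ballI p)
  fix q :: "'a mpoly" assume "q \<in> Rpolys n"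
  then obtain r where r: "r \<in> mspan (set B')" "q - r \<in> I" using B'(2) unfolding classes_basis_def by blast
  have "dual_app \<phi> (p * q) = dual_app \<phi> (r * p) + dual_app \<phi> ((q - r) * p)"
    by (simp add: dual_app_add[symmetric] algebra_simps)
  also have "dual_app \<phi> (r * p) = 0" by (rule dual_app_zero_span[OF z r(1)])
  also have "dual_app \<phi> ((q - r) * p) = 0" using r(2) p by (simp add: Iphi_iff)
  finally show "dual_app \<phi> (p * q) = 0" by simp
qed

lemma list_comb_B_eq_0:
  assumes "\<And>b. b \<in> set B' \<Longrightarrow> dual_app \<phi> (b * list_comb B a) = 0" "j < length B"
  shows "a j = 0"
proof -
  have "list_comb B a \<in> Rpolys n"
    using list_comb_in_span mp.span_minimal[OF set_B_Rpolys(1) subspace_Rpolys] by blast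
  then have "list_comb B a \<in> I" using assms(1) by (rule in_I_if_orthogonal_B')
  then show ?thesis using classes_basis_list_comb[OF B] assms(2) by blast
qed

lemma hankel_index:
  assumes "i < length Q" "j < length P" "Q ! i \<in> mspan (set A')" "P ! j \<in> mspan (set A)"
  shows "hankel d f Q P $$ (i, j) = dual_app \<phi> (Q ! i * P ! j)"
  using assms by (simp add: hankel_def fcheck_span)

lemma hankel_mult_vec:
  assumes "set Q \<subseteq> mspan (set A')" "set P \<subseteq> mspan (set A)" "x \<in> carrier_vec (length P)" "i < length Q"
  shows "(hankel d f Q P *\<^sub>v x) $ i = dual_app \<phi> (Q ! i * list_comb P (vec_index x))"
proof -
  have "(hankel d f Q P *\<^sub>v x) $ i = (\<Sum>j<length P. hankel d f Q P $$ (i, j) * x $ j)"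
    using assms by (simp add: hankel_def scalar_prod_def atLeast0LessThan)
  also have "\<dots> = (\<Sum>j<length P. dual_app \<phi> (Q ! i * P ! j) * x $ j)"
  proof (rule sum.cong[OF refl])
    fix j assume "j \<in> {..<length P}"
    then have "hankel d f Q P $$ (i, j) = dual_app \<phi> (Q ! i * P ! j)"
      using assms by (intro hankel_index) auto
    then show "hankel d f Q P $$ (i, j) * x $ j = dual_app \<phi> (Q ! i * P ! j) * x $ j" by simp
  qed
  finally show ?thesis by (simp only: dual_app_list_comb)
qed

lemma H0_carrier: "H\<^sub>0 \<in> carrier_mat (length B) (length B)"
  by (simp add: hankel_def len)

text \<open>A kernel vector is a combination of \<open>B\<close> orthogonal to \<open>Q\<close>,
  hence to \<open>B'\<close>. The choice Q = B' gives the invertibility of \<open>H\<^sub>0\<close>,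
  and Q = A' the rank.\<close>

lemma hankel_B_kernel:
  assumes "set Q \<subseteq> mspan (set A')" "set B' \<subseteq> mspan (set Q)"
    and "x \<in> carrier_vec (length B)" "hankel d f Q B *\<^sub>v x = 0\<^sub>v (length Q)"
  shows "x = 0\<^sub>v (length B)"
proof (rule eq_vecI)
  fix j assume j: "j < dim_vec (0\<^sub>v (length B) :: 'a vec)"
  have "dual_app \<phi> (q * list_comb B (vec_index x)) = 0" if q: "q \<in> set Q" for q
  proof -
    obtain i where i: "i < length Q" "q = Q ! i" using q by (auto simp: in_set_conv_nth)
    then show ?thesis using hankel_mult_vec[OF assms(1) B_span_A assms(3) i(1)] assms(4) by simp
  qed
  then have "dual_app \<phi> (b * list_comb B (vec_index x)) = 0" if "b \<in> set B'" for b
    using dual_app_zero_span[of Q _ b] that assms(2) by blast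
  then show "x $ j = 0\<^sub>v (length B) $ j" using list_comb_B_eq_0[of "vec_index x" j] j by simp
qed (use assms in auto)

lemma obtain_H0_inverse:
  obtains M where "mat_inverse H\<^sub>0 = Some M" "M \<in> carrier_mat (length B) (length B)"
    "H\<^sub>0 * M = 1\<^sub>m (length B)" "M * H\<^sub>0 = 1\<^sub>m (length B)"
proof (rule mat_inverse_if_trivial_kernel[OF H0_carrier])
  show "x = 0\<^sub>v (length B)" if "x \<in> carrier_vec (length B)" "H\<^sub>0 *\<^sub>v x = 0\<^sub>v (length B)" for x
    by (rule hankel_B_kernel[OF BA' mp.span_superset]) (use that len in auto)
qed

lemma H0_invertible: "invertible_mat H\<^sub>0"
proof -
  obtain M where "M \<in> carrier_mat (length B) (length B)" "H\<^sub>0 * M = 1\<^sub>m (length B)" "M * H\<^sub>0 = 1\<^sub>m (length B)"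
    using obtain_H0_inverse .
  then show ?thesis using H0_carrier unfolding invertible_mat_def inverts_mat_def by auto
qed

lemma dual_app_reduce:
  assumes "p - q \<in> I" "r \<in> Rpolys n"
  shows "dual_app \<phi> (r * p) = dual_app \<phi> (r * q)"
proof -
  have "dual_app \<phi> (r * (p - q)) = 0" using assms by (simp add: Iphi_iff mult.commute[of r])
  then show ?thesis by (simp only: right_diff_distrib dual_app_diff right_minus_eq)
qed

text \<open>The pairing depends on a column polynomial only modulo I_\<phi>, so congruences between
  columns become a matrix factorization.\<close>

lemma hankel_factor:
  assumes Q: "set Q \<subseteq> mspan (set A')" and P: "set P \<subseteq> mspan (set A)" and P': "set P' \<subseteq> mspan (set A)"
    and Y: "\<And>j. j < length P' \<Longrightarrow> P' ! j - list_comb P (Y j) \<in> I"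
  shows "hankel d f Q P' = hankel d f Q P * mat (length P) (length P') (\<lambda>(i, j). Y j i)"
proof (rule eq_matI)
  fix i j
  assume ij: "i < dim_row (hankel d f Q P * mat (length P) (length P') (\<lambda>(i, j). Y j i))"
    "j < dim_col (hankel d f Q P * mat (length P) (length P') (\<lambda>(i, j). Y j i))"
  then have i: "i < length Q" and j: "j < length P'" by (auto simp: hankel_def)
  have QR: "Q ! i \<in> Rpolys n" using i Q span_A' Rle_subset_Rpolys by (meson nth_mem subsetD)
  let ?x = "vec (length P) (Y j)"
  have lc: "list_comb P (Y j) = list_comb P (vec_index ?x)" unfolding list_comb_def by (rule sum.cong) auto
  have "hankel d f Q P' $$ (i, j) = dual_app \<phi> (Q ! i * P' ! j)"
    using i j Q P' by (intro hankel_index) auto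
  also have "\<dots> = dual_app \<phi> (Q ! i * list_comb P (vec_index ?x))"
    using dual_app_reduce[OF Y[OF j] QR] lc by simp
  also have "\<dots> = (hankel d f Q P *\<^sub>v ?x) $ i"
    by (rule hankel_mult_vec[OF Q P _ i, symmetric]) simp
  also have "\<dots> = (hankel d f Q P * mat (length P) (length P') (\<lambda>(i, j). Y j i)) $$ (i, j)"
  proof -
    have "col (mat (length P) (length P') (\<lambda>(i, j). Y j i)) j = ?x" using j by auto
    then show ?thesis using i j by (simp add: hankel_def)
  qed
  finally show "hankel d f Q P' $$ (i, j) = (hankel d f Q P * mat (length P) (length P') (\<lambda>(i, j). Y j i)) $$ (i, j)" .
qed (auto simp: hankel_def)

lemma reduce_mod_I:
  assumes "\<And>j. j < length P \<Longrightarrow> P ! j \<in> Rpolys n"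
  obtains Y where "\<And>j. j < length P \<Longrightarrow> P ! j - list_comb B (Y j) \<in> I"
proof -
  have "\<exists>a. j < length P \<longrightarrow> P ! j - list_comb B a \<in> I" for j
    using assms classes_basis_reduce[OF B(2,1)] by metis
  then show thesis using that by metis
qed

text \<open>If \<open>Y\<close> holds the coordinates of the x_i b_j modulo I_\<phi>, then H_i =
  \<open>H\<^sub>0\<close> Y, and \<open>H\<^sub>0\<close> cancels.\<close>

lemma mult_matrix_H0:
  assumes i: "i \<in> {1..n}"
  shows "mult_matrix I B i (the (mat_inverse H\<^sub>0) * hankel d f B' (map (\<lambda>b. Var i * b) B))"
proof -
  let ?P = "map (\<lambda>b. Var i * b) B"
  have R: "?P ! j \<in> Rpolys n" if "j < length ?P" for j
    using that by (simp add: Rpolys_mult[OF Var_in_Rpolys[OF i]] subsetD[OF set_B_Rpolys(1)])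
  obtain Y where Y: "\<And>j. j < length ?P \<Longrightarrow> ?P ! j - list_comb B (Y j) \<in> I"
    using reduce_mod_I[of ?P] R by metis
  let ?Y = "mat (length B) (length ?P) (\<lambda>(i, j). Y j i)"
  have f: "hankel d f B' ?P = H\<^sub>0 * ?Y"
    using BA' B_span_A Var_B_span_A[OF i] Y by (intro hankel_factor) auto
  obtain M where M: "mat_inverse H\<^sub>0 = Some M" "M \<in> carrier_mat (length B) (length B)"
    "M * H\<^sub>0 = 1\<^sub>m (length B)" using obtain_H0_inverse .
  have Yc: "?Y \<in> carrier_mat (length B) (length B)" by simp
  have "M * (H\<^sub>0 * ?Y) = (M * H\<^sub>0) * ?Y" by (rule assoc_mult_mat[OF M(2) H0_carrier Yc, symmetric])
  also have "\<dots> = ?Y" unfolding M(3) by (rule left_mult_one_mat[OF Yc])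
  finally have "the (mat_inverse H\<^sub>0) * hankel d f B' ?P = ?Y" by (simp only: M(1) f option.sel)
  moreover have "(\<Sum>l<length B. smult_mp (?Y $$ (l, j)) (B ! l)) = list_comb B (Y j)" if "j < length B" for j
    unfolding list_comb_def by (rule sum.cong) (use that in auto)
  ultimately show ?thesis using Y Yc unfolding mult_matrix_def by simp
qed

lemma A_Rpolys: "mspan (set A) \<subseteq> Rpolys n"
  using span_A Rle_subset_Rpolys by blast

text \<open>With the rows kept at \<open>A'\<close>, the columns \<open>A\<close> may be exchanged
  for \<open>B\<close>: \<open>A\<close> reduces to \<open>B\<close> modulo I_\<phi>, and
  \<open>B\<close> lies in the span of \<open>A\<close>. The columns for \<open>B\<close> are
  independent.\<close>

lemma rank_hankel: "vec_space.rank (length A') (hankel d f A' A) = length B"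
proof -
  obtain Y where Y: "\<And>j. j < length A \<Longrightarrow> A ! j - list_comb B (Y j) \<in> I"
    using reduce_mod_I[of A] A_Rpolys mp.span_base[of _ "set A"] by (metis nth_mem subsetD)
  have "\<exists>a. j < length B \<longrightarrow> B ! j = list_comb A a" for j
    using span_list_comb[OF A(1), of "B ! j"] B_span_A by (metis nth_mem subsetD)
  then obtain X where X: "\<And>j. j < length B \<Longrightarrow> B ! j = list_comb A (X j)" by metis
  have X': "B ! j - list_comb A (X j) \<in> I" if "j < length B" for j
    using X[OF that] mp.subspace_0[OF subspace_Iphi, of n \<phi>] by simp
  have "vec_space.rank (length A') (hankel d f A' A) = vec_space.rank (length A') (hankel d f A' B)"
    using hankel_factor[OF mp.span_superset B_span_A mp.span_superset Y]
      hankel_factor[OF mp.span_superset mp.span_superset B_span_A X']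
    by (intro vec_space.rank_eq_if_factors[where a = "length A" and b = "length B"]) (auto simp: hankel_def)
  also have "\<dots> = length B"
  proof (rule vec_space.rank_eq_if_trivial_kernel)
    show "x = 0\<^sub>v (length B)" if "x \<in> carrier_vec (length B)" "hankel d f A' B *\<^sub>v x = 0\<^sub>v (length A')" for x
      by (rule hankel_B_kernel[OF mp.span_superset BA' that])
  qed (simp add: hankel_def)
  finally show ?thesis .
qed

lemma hank_ker_eq: "hank_ker d f A' A = I \<inter> mspan (set A)"
proof (intro equalityI subsetI)
  fix p assume "p \<in> hank_ker d f A' A"
  then have p: "p \<in> mspan (set A)" and eq: "hank_op d f A' p = (\<lambda>q\<in>mspan (set A'). 0)"
    by (auto simp: hank_ker_def)
  have "dual_app \<phi> (b * p) = 0" if b: "b \<in> set B'" for b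
  proof -
    have bA: "b \<in> mspan (set A')" using b BA' by blast
    have "dual_app (fcheck d f) (p * b) = 0" using fun_cong[OF eq, of b] bA by (simp add: hank_op_def)
    then show ?thesis using fcheck_span[OF p bA] by (simp add: mult.commute)
  qed
  then have "p \<in> I" using p A_Rpolys by (intro in_I_if_orthogonal_B') auto
  then show "p \<in> I \<inter> mspan (set A)" using p by blast
next
  fix p assume p: "p \<in> I \<inter> mspan (set A)"
  have "dual_app (fcheck d f) (p * q) = 0" if q: "q \<in> mspan (set A')" for q
  proof -
    have "q \<in> Rpolys n" using q span_A' Rle_subset_Rpolys by blast
    then have "dual_app \<phi> (p * q) = 0" using p by (simp add: Iphi_iff)
    then show ?thesis using fcheck_span[of p q] p q by (simp add: mult.commute)
  qed
  then show "p \<in> hank_ker d f A' A" using p by (auto simp: hank_ker_def hank_op_def restrict_def)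
qed

text \<open>Rewriting modulo the ideal of the kernel brings every polynomial into the span of
  \<open>B\<close>, variable by variable and without a monomial order. For an element of I_\<phi>
  the remainder lies in I_\<phi> and in the span of \<open>B\<close>, so it is zero.\<close>

lemma ideal_hank_ker: "ideal_R n (hank_ker d f A' A) = I"
proof
  let ?J = "ideal_R n (hank_ker d f A' A)"
  show "?J \<subseteq> I" by (rule ideal_R_subset) (simp add: hank_ker_eq)
  have span_B: "mspan (set B) \<subseteq> mspan (set A)" by (rule mp.span_minimal[OF B_span_A mp.subspace_span])
  have Var_span: "\<exists>r\<in>mspan (set B). Var i * q - r \<in> ?J" if i: "i \<in> {1..n}" and q: "q \<in> mspan (set B)" for i q
    using q
  proof (induction rule: mp.span_induct_alt)
    case base
    show ?case by (rule bexI[OF _ mp.span_zero]) (simp add: mp.subspace_0[OF subspace_ideal_R])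
  next
    case (step a b q)
    then obtain r where r: "r \<in> mspan (set B)" "Var i * q - r \<in> ?J" by blast
    have "Var i * b \<in> Rpolys n" using step(1) set_B_Rpolys Rpolys_mult[OF Var_in_Rpolys[OF i]] by blast
    then obtain t where t: "t \<in> mspan (set B)" "Var i * b - t \<in> I" using B(2) unfolding classes_basis_def by blast
    \<comment> \<open>The inclusion of \<open>Bplus\<close> in the span of \<open>A\<close> puts the
      reduction rule into the domain of the operator.\<close>
    have "Var i * b - t \<in> mspan (set A)"
      using t(1) span_B Var_B_span_A[OF i step(1)] by (intro mp.span_diff) auto
    then have "Var i * b - t \<in> ?J" using t(2) by (intro ideal_R_base) (simp add: hank_ker_eq)
    then have "smult_mp a (Var i * b - t) + (Var i * q - r) \<in> ?J"
      using r(2) by (intro mp.subspace_add[OF subspace_ideal_R] mp.subspace_scale[OF subspace_ideal_R])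
    moreover have "smult_mp a (Var i * b - t) + (Var i * q - r) = Var i * (smult_mp a b + q) - (smult_mp a t + r)"
      by (simp add: distrib_left smult_mp_mult_right mp.scale_right_diff_distrib)
    ultimately have "Var i * (smult_mp a b + q) - (smult_mp a t + r) \<in> ?J" by simp
    moreover have "smult_mp a t + r \<in> mspan (set B)" using r t by (intro mp.span_add mp.span_scale)
    ultimately show ?case by blast
  qed
  have normal_form: "\<exists>r\<in>mspan (set B). p - r \<in> ?J" if "p \<in> Rpolys n" for p
    using that
  proof (induction rule: Rpolys_induct)
    case one
    show ?case by (rule bexI[OF _ mp.span_base[OF one_B]]) (simp add: mp.subspace_0[OF subspace_ideal_R])
  next
    case (Var j q)
    then obtain r where r: "r \<in> mspan (set B)" "q - r \<in> ?J" by blast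
    obtain t where t: "t \<in> mspan (set B)" "Var j * r - t \<in> ?J" using Var_span[OF Var.hyps(1) r(1)] by blast
    have "Var j * (q - r) + (Var j * r - t) \<in> ?J"
      using r t Var_in_Rpolys[OF Var.hyps(1)] by (intro ideal_R_add ideal_R_mult)
    then have "Var j * q - t \<in> ?J" by (simp add: right_diff_distrib)
    then show ?case using t by blast
  next
    case (add p q)
    then obtain r t where r: "r \<in> mspan (set B)" "p - r \<in> ?J" "t \<in> mspan (set B)" "q - t \<in> ?J" by blast
    have "(p - r) + (q - t) \<in> ?J" using r by (intro ideal_R_add)
    then have "(p + q) - (r + t) \<in> ?J" by (simp add: algebra_simps)
    then show ?case using r mp.span_add by blast
  next
    case (smult a q)
    then obtain r where r: "r \<in> mspan (set B)" "q - r \<in> ?J" by blast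
    have "smult_mp a (q - r) \<in> ?J" using r by (intro mp.subspace_scale[OF subspace_ideal_R])
    then have "smult_mp a q - smult_mp a r \<in> ?J" by (simp add: mp.scale_right_diff_distrib)
    then show ?case using r mp.span_scale by blast
  qed
  show "I \<subseteq> ?J"
  proof
    fix p assume p: "p \<in> I"
    then have "p \<in> Rpolys n" using Iphi_subset_Rpolys by blast
    then obtain r where r: "r \<in> mspan (set B)" "p - r \<in> ?J" using normal_form by blast
    have "p - r \<in> I" using \<open>?J \<subseteq> I\<close> r(2) by blast
    from mp.subspace_diff[OF subspace_Iphi p this] have "p - (p - r) \<in> I" .
    then have rI: "r \<in> I" by simp
    obtain a where a: "r = list_comb B a" using span_list_comb[OF B(1) r(1)] .
    then have "a j = 0" if "j < length B" for j using classes_basis_list_comb[OF B] rI that by blast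
    then have "r = 0" unfolding a list_comb_def by (intro sum.neutral) auto
    then show "p \<in> ?J" using r by simp
  qed
qed

text \<open>For the harder inclusion, \<open>H\<^sub>0\<close> x = (\<psi>(b')) is solved over b' in
  \<open>B'\<close>. The polynomial p with coordinates x then satisfies \<phi>(q p) = \<psi>(q) on
  \<open>B'\<close>, and on all of R because both sides vanish for q in I_\<phi>.\<close>

lemma hank_im_eq:
  "hank_im d f A' A = {(\<lambda>q\<in>mspan (set A'). dual_app \<psi> q) | \<psi>. \<forall>p\<in>I. dual_app \<psi> p = 0}"
proof (intro equalityI subsetI)
  fix h assume "h \<in> hank_im d f A' A"
  then obtain p where p: "p \<in> mspan (set A)" "h = hank_op d f A' p" by (auto simp: hank_im_def)
  have "h = (\<lambda>q\<in>mspan (set A'). dual_app (star p \<phi>) q)"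
    unfolding p(2) hank_op_def
    by (rule restrict_ext) (use fcheck_span[OF p(1)] in \<open>simp add: dual_app_star mult.commute\<close>)
  moreover have "\<forall>q\<in>I. dual_app (star p \<phi>) q = 0"
    using p(1) A_Rpolys by (auto simp: dual_app_star Iphi_iff mult.commute[of p])
  ultimately show "h \<in> {(\<lambda>q\<in>mspan (set A'). dual_app \<psi> q) | \<psi>. \<forall>p\<in>I. dual_app \<psi> p = 0}" by blast
next
  fix h assume "h \<in> {(\<lambda>q\<in>mspan (set A'). dual_app \<psi> q) | \<psi>. \<forall>p\<in>I. dual_app \<psi> p = 0}"
  then obtain \<psi> where \<psi>: "h = (\<lambda>q\<in>mspan (set A'). dual_app \<psi> q)" "\<And>p. p \<in> I \<Longrightarrow> dual_app \<psi> p = 0" by blast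
  obtain M where M: "M \<in> carrier_mat (length B) (length B)" "H\<^sub>0 * M = 1\<^sub>m (length B)" using obtain_H0_inverse .
  define y where "y = vec (length B) (\<lambda>i. dual_app \<psi> (B' ! i))"
  define x where "x = M *\<^sub>v y"
  have y: "y \<in> carrier_vec (length B)" by (simp add: y_def)
  have x: "x \<in> carrier_vec (length B)" unfolding x_def by (rule mult_mat_vec_carrier[OF M(1) y])
  have "H\<^sub>0 *\<^sub>v x = (H\<^sub>0 * M) *\<^sub>v y" unfolding x_def by (rule assoc_mult_mat_vec[OF H0_carrier M(1) y, symmetric])
  also have "\<dots> = y" unfolding M(2) by (rule one_mult_mat_vec[OF y])
  finally have Hx: "H\<^sub>0 *\<^sub>v x = y" .
  define p where "p = list_comb B (vec_index x)"
  have pA: "p \<in> mspan (set A)"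
    unfolding p_def using list_comb_in_span mp.span_minimal[OF B_span_A mp.subspace_span] by blast
  then have pR: "p \<in> Rpolys n" using A_Rpolys by blast
  have base: "dual_app \<phi> (b * p) = dual_app \<psi> b" if b: "b \<in> set B'" for b
  proof -
    obtain i where i: "i < length B'" "b = B' ! i" using b by (auto simp: in_set_conv_nth)
    have "dual_app \<phi> (b * p) = (H\<^sub>0 *\<^sub>v x) $ i"
      unfolding p_def i(2) by (rule hankel_mult_vec[OF BA' B_span_A x i(1), symmetric])
    then show ?thesis using i len by (simp add: Hx y_def)
  qed
  have sp: "dual_app \<phi> (q * p) = dual_app \<psi> q" if "q \<in> mspan (set B')" for q
    using that
  proof (induction rule: mp.span_induct_alt)
    case (step a x y)
    then show ?case by (simp add: distrib_right dual_app_add smult_mp_mult_left dual_app_smult base)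
  qed simp
  have all: "dual_app \<phi> (q * p) = dual_app \<psi> q" if q: "q \<in> Rpolys n" for q
  proof -
    obtain r where r: "r \<in> mspan (set B')" "q - r \<in> I" using q B'(2) unfolding classes_basis_def by blast
    have "dual_app \<phi> (p * q) = dual_app \<phi> (p * r)" by (rule dual_app_reduce[OF r(2) pR])
    moreover have "dual_app \<psi> q = dual_app \<psi> r" using \<psi>(2)[OF r(2)] by (simp add: dual_app_diff)
    ultimately show ?thesis using sp[OF r(1)] by (simp only: mult.commute[of p])
  qed
  have "hank_op d f A' p = h"
    unfolding \<psi>(1) hank_op_def
  proof (rule restrict_ext)
    fix q assume q: "q \<in> mspan (set A')"
    then have "q \<in> Rpolys n" using span_A' Rle_subset_Rpolys by blast
    then show "dual_app (fcheck d f) (p * q) = dual_app \<psi> q"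
      using fcheck_span[OF pA q] all by (simp only: mult.commute[of p])
  qed
  then show "h \<in> hank_im d f A' A" using pA by (auto simp: hank_im_def)
qed

end

section \<open>Distinct points and the assembly of the theorem\<close>

lemma lin_form_separated:
  assumes "\<not> (\<exists>a. lin_form n \<xi> = smult_mp a (lin_form n \<zeta>))"
  shows "\<exists>m\<in>{1..n}. \<xi> m \<noteq> \<zeta> m"
proof (rule ccontr)
  assume "\<not> ?thesis"
  then have "lin_form n \<xi> = smult_mp 1 (lin_form n \<zeta>)" by (simp add: lin_form_def)
  then show False using assms by blast
qed

theorem theorem4p12:
  fixes f :: "'a::field_char_0 mpoly" and \<omega> :: "nat \<Rightarrow> 'a mpoly" and k :: "nat \<Rightarrow> nat"
    and \<xi> :: "nat \<Rightarrow> nat \<Rightarrow> 'a" and B B' A A' :: "'a mpoly list" and n d s c :: nat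
  assumes "f \<in> Shom n d"
    and "is_GAD n d f s \<omega> k \<xi>"
    and "distinct B" and "distinct B'"
    and "classes_basis n (Iphi n (phi n d s \<omega> k \<xi>)) (set B)"
    and "classes_basis n (Iphi n (phi n d s \<omega> k \<xi>)) (set B')"
    and "1 \<in> set B"
    and "c \<le> d"
    and "distinct A" and "distinct A'"
    and "set A \<subseteq> Rle n c" and "set A' \<subseteq> Rle n (d - c)"
    and "mindep (set A)" and "mindep (set A')"
    and "Bplus n (set B) \<subseteq> mspan (set A)" and "set B' \<subseteq> mspan (set A')"
  shows "invertible_mat (hankel d f B' B) \<and>
    vec_space.rank (length A') (hankel d f A' A) = length B \<and>
    length B = (\<Sum>i<s. mdim (inv_sys n d (lin_form n (\<xi> i)) (k i) (\<omega> i))) \<and>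
    (\<forall>i\<in>{1..n}. mult_matrix (Iphi n (phi n d s \<omega> k \<xi>)) B i
           (the (mat_inverse (hankel d f B' B)) * hankel d f B' (map (\<lambda>b. Var i * b) B))) \<and>
    hank_ker d f A' A = Iphi n (phi n d s \<omega> k \<xi>) \<inter> mspan (set A) \<and>
    ideal_R n (hank_ker d f A' A) = Iphi n (phi n d s \<omega> k \<xi>) \<and>
    hank_im d f A' A = {(\<lambda>q\<in>mspan (set A'). dual_app \<psi> q) | \<psi>.
           \<forall>p\<in>Iphi n (phi n d s \<omega> k \<xi>). dual_app \<psi> p = 0}"
proof -
  let ?\<phi> = "phi n d s \<omega> k \<xi>"
  let ?W = "\<lambda>i. omega_dl n d (lin_form n (\<xi> i)) (k i) (\<omega> i)"
  have W: "?W i \<in> Rpolys n" if "i \<in> {..<s}" for i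
    using that assms(2) by (intro omega_dl_in_Rpolys) (auto simp: is_GAD_def)
  have supp: "?\<phi> \<alpha> = 0" if "\<not> Poly_Mapping.keys \<alpha> \<subseteq> {1..n}" for \<alpha>
    unfolding phi_eq_sum_pexp by (rule sum.neutral) (use W pexp_supported that in blast)
  have \<phi>_sum: "?\<phi> = (\<Sum>i<s. pexp n (\<xi> i) (?W i))"
  proof -
    have "(\<Sum>i\<in>F. pexp n (\<xi> i) (?W i)) \<alpha> = (\<Sum>i\<in>F. pexp n (\<xi> i) (?W i) \<alpha>)" for F \<alpha>
      by (induction F rule: infinite_finite_induct) simp_all
    then show ?thesis by (simp add: fun_eq_iff phi_eq_sum_pexp)
  qed
  have sep: "\<exists>m\<in>{1..n}. \<xi> i m \<noteq> \<xi> j m" if "i \<in> {..<s}" "j \<in> {..<s}" "j \<noteq> i" for i j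
    using that assms(2) by (intro lin_form_separated) (auto simp: is_GAD_def)
  \<comment> \<open>Stated for any basis list: applied to \<open>B\<close> it gives the dimension
    formula, and to \<open>B\<close> and \<open>B'\<close> together the equality of their
    lengths.\<close>
  have len: "length X = fn.dim (orbit n ?\<phi>)" "orbit n ?\<phi> \<subseteq> fn.span ((\<lambda>p. star p ?\<phi>) ` set X)"
    if "distinct X" "classes_basis n (Iphi n ?\<phi>) (set X)" for X
    using length_classes_basis[where \<phi> = ?\<phi>, OF _ that] supp by blast+
  have "fn.dim (orbit n ?\<phi>) = (\<Sum>i\<in>{..<s}. mdim (derivs n (?W i)))"
    by (rule dim_orbit_sum_pexp[OF W _ sep \<phi>_sum _ len(2)[OF assms(3,5)]]) auto
  then have dim: "length B = (\<Sum>i<s. mdim (inv_sys n d (lin_form n (\<xi> i)) (k i) (\<omega> i)))"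
    using len(1)[OF assms(3,5)] by (simp add: inv_sys_conv_derivs)
  have agree: "dual_app (fcheck d f) p = dual_app ?\<phi> p" if "p \<in> Rle n d" for p
    unfolding dual_app_def
    by (rule sum.cong[OF refl]) (use that fcheck_eq_phi[OF assms(2)] in \<open>auto simp: Rle_def Rpolys_def\<close>)
  interpret hankel_extension n d c f ?\<phi> B B' A A'
    by unfold_locales (use assms agree len(1)[OF assms(3,5)] len(1)[OF assms(4,6)] in auto)
  show ?thesis
    using H0_invertible rank_hankel dim mult_matrix_H0 hank_ker_eq ideal_hank_ker hank_im_eq by blast
qed

end
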